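(* Let $G$ be a polycyclic-by-finite group with polynomial subgroup growth and Hirsch length at least $2$, and let $\alpha$ be an action of $G$ on a set $X$ such that $\mathsf{F}_\alpha(L)<\infty$ for all $L\in\mathcal{L}_G$ and $\mathsf{F}_\alpha(L)=0$ for at most finitely many $L\in\mathcal{L}_G$. If $\mathsf{g}(\alpha)=0$ and the formal power series for $\zeta_\alpha$ has integer coefficients, then $\zeta_\alpha$ has the unit circle as a natural boundary.
   Context: For a finitely generated group $G$, $\mathcal{L}_G$ denotes the set of finite index subgroups of $G$, $[L]=[G:L]$ for $L\in\mathcal{L}_G$, and $a_G(n)$ is the (finite) number of subgroups of index $n$. $G$ has polynomial subgroup growth (is a PSG group) if $a_G(n)$ grows at most polynomially in $n$. If $G$ is polycyclic-by-finite, there is a finite index subgroup $G_m\leqslant G$ with a subnormal series $\{1\}=G_0\lhd G_1\lhd\dots\lhd G_m$ with each $G_k/G_{k-1}$ infinite cyclic; the number $m$ is an invariant of $G$, called its Hirsch length. For a $G$-action $\alpha$ on a set $X$ and $L\in\mathcal{L}_G$, $\mathsf{F}_\alpha(L)$ is the cardinality of $\{x\in X: gx=x\text{ for all }g\in L\}$. The dynamical zeta function of $\alpha$ is the formal power series $\zeta_\alpha(z)=\exp\sum_{L\in\mathcal{L}_G}\frac{\mathsf{F}_\alpha(L)}{[L]}z^{[L]}$. The upper growth rate is \[ \mathsf{g}(\alpha)=\limsup_{[L]\to\infty}\frac{1}{[L]}\log\mathsf{F}_\alpha(L)=\lim_{n\to\infty}\sup_{[L]\geqslant n}\frac{1}{[L]}\log\mathsf{F}_\alpha(L).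 \] A power series with radius of convergence $R\in(0,\infty)$ has the circle $|z|=R$ as a natural boundary if the function it defines on $|z|<R$ cannot be continued analytically across any point of that circle. *)

theory Defs
  imports
    "HOL-Analysis.Analysis"
    "HOL-Algebra.Group_Action"
    "HOL-Algebra.Elementary_Groups"
begin

definition finite_index_subgroups :: "('a, 'c) monoid_scheme \<Rightarrow> 'a set set" where
  "finite_index_subgroups G = {L. subgroup L G \<and> finite (rcosets\<^bsub>G\<^esub> L)}"

text \<open>Only meaningful for subgroups of finite index, where it is positive.\<close>

definition subgroup_index :: "('a, 'c) monoid_scheme \<Rightarrow> 'a set \<Rightarrow> nat" where
  "subgroup_index G L = card (rcosets\<^bsub>G\<^esub> L)"

text \<open>The set counted below is finite for every finitely generated group, in particular for
  every polycyclic-by-finite group.\<close>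

definition num_subgroups :: "('a, 'c) monoid_scheme \<Rightarrow> nat \<Rightarrow> nat" where
  "num_subgroups G n = card {L \<in> finite_index_subgroups G. subgroup_index G L = n}"

definition polynomial_subgroup_growth :: "('a, 'c) monoid_scheme \<Rightarrow> bool" where
  "polynomial_subgroup_growth G \<longleftrightarrow>
     (\<exists>C k. \<forall>n\<ge>1. real (num_subgroups G n) \<le> C * real n ^ k)"

text \<open>A series \<open>{\<one>} = S 0 \<lhd> S 1 \<lhd> \<dots> \<lhd> S m\<close> of subsets of \<open>G\<close> whose factors satisfy \<open>P\<close>. When
  \<open>S m\<close> is a subgroup of \<open>G\<close>, so are all the \<open>S k\<close>.\<close>

definition subnormal_series ::
  "('a, 'c) monoid_scheme \<Rightarrow> ('a set monoid \<Rightarrow> bool) \<Rightarrow> nat \<Rightarrow> (nat \<Rightarrow> 'a set) \<Rightarrow> bool" where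
  "subnormal_series G P m S \<longleftrightarrow>
     S 0 = {\<one>\<^bsub>G\<^esub>} \<and>
     (\<forall>k<m. S k \<lhd> (G\<lparr>carrier := S (Suc k)\<rparr>) \<and> P (G\<lparr>carrier := S (Suc k)\<rparr> Mod S k))"

definition polycyclic :: "('a, 'c) monoid_scheme \<Rightarrow> bool" where
  "polycyclic G \<longleftrightarrow>
     group G \<and> (\<exists>m S. subnormal_series G cyclic_group m S \<and> S m = carrier G)"

definition polycyclic_by_finite :: "('a, 'c) monoid_scheme \<Rightarrow> bool" where
  "polycyclic_by_finite G \<longleftrightarrow>
     (\<exists>N. N \<lhd> G \<and> finite (rcosets\<^bsub>G\<^esub> N) \<and> polycyclic (G\<lparr>carrier := N\<rparr>))"

text \<open>The Hirsch length is given as a relation, so that its uniqueness is not built into the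
  definition.\<close>

definition has_hirsch_length :: "('a, 'c) monoid_scheme \<Rightarrow> nat \<Rightarrow> bool" where
  "has_hirsch_length G m \<longleftrightarrow>
     (\<exists>S. subnormal_series G (\<lambda>Q. cyclic_group Q \<and> infinite (carrier Q)) m S \<and>
          S m \<in> finite_index_subgroups G)"

definition fixed_points :: "'b set \<Rightarrow> ('a \<Rightarrow> 'b \<Rightarrow> 'b) \<Rightarrow> 'a set \<Rightarrow> 'b set" where
  "fixed_points X \<alpha> L = {x \<in> X. \<forall>g\<in>L. \<alpha> g x = x}"

text \<open>Only meaningful when the set of fixed points is finite; the same restriction applies to
  the growth rate and the zeta function below.\<close>

definition num_fixed :: "'b set \<Rightarrow> ('a \<Rightarrow> 'b \<Rightarrow> 'b) \<Rightarrow> 'a set \<Rightarrow> nat" where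
  "num_fixed X \<alpha> L = card (fixed_points X \<alpha> L)"

text \<open>Logarithm with \<open>log 0 = -\<infinity>\<close>, in contrast to \<open>ln 0 = 0\<close> on the reals.\<close>

definition log_nat :: "nat \<Rightarrow> ereal" where
  "log_nat n = (if n = 0 then -\<infinity> else ereal (ln (real n)))"

definition upper_growth_rate ::
  "('a, 'c) monoid_scheme \<Rightarrow> 'b set \<Rightarrow> ('a \<Rightarrow> 'b \<Rightarrow> 'b) \<Rightarrow> ereal" where
  "upper_growth_rate G X \<alpha> =
     lim (\<lambda>n. SUP L \<in> {L \<in> finite_index_subgroups G. n \<le> subgroup_index G L}.
                log_nat (num_fixed X \<alpha> L) / ereal (real (subgroup_index G L)))"

text \<open>The formal sum over all finite index subgroups \<open>L\<close> of \<open>(F(L) / [L]) z^[L]\<close>, collected by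
  powers of \<open>z\<close>. The constant term is \<open>0\<close>, as no finite index subgroup has index \<open>0\<close>.\<close>

definition zeta_exponent ::
  "('a, 'c) monoid_scheme \<Rightarrow> 'b set \<Rightarrow> ('a \<Rightarrow> 'b \<Rightarrow> 'b) \<Rightarrow> complex fps" where
  "zeta_exponent G X \<alpha> =
     Abs_fps (\<lambda>n. \<Sum>L \<in> {L \<in> finite_index_subgroups G. subgroup_index G L = n}.
                of_nat (num_fixed X \<alpha> L) / of_nat (subgroup_index G L))"

definition dynamical_zeta ::
  "('a, 'c) monoid_scheme \<Rightarrow> 'b set \<Rightarrow> ('a \<Rightarrow> 'b \<Rightarrow> 'b) \<Rightarrow> complex fps" where
  "dynamical_zeta G X \<alpha> = fps_compose (fps_exp 1) (zeta_exponent G X \<alpha>)"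

definition has_natural_boundary :: "complex fps \<Rightarrow> real \<Rightarrow> bool" where
  "has_natural_boundary f R \<longleftrightarrow>
     0 < R \<and> fps_conv_radius f = ereal R \<and>
     (\<forall>w\<in>sphere 0 R. \<not> (\<exists>r>0. \<exists>h. h holomorphic_on ball w r \<and>
        (\<forall>z\<in>ball w r \<inter> ball 0 R. h z = eval_fps f z)))"

end

(* By the Polya-Carlson theorem, a power series with integer coefficients that converges in the
   unit disc and continues across a point of the unit circle is rational: the closed disc with a
   cap removed has capacity less than 1, so in a suitable basis of polynomials the entries of the
   Hankel matrices of the coefficients decay geometrically; the Hankel determinants tend to 0
   and, being integers, vanish eventually, and Kronecker's criterion applies.

   A rational zeta_alpha has neither zeros nor poles in the disc, being an exponential, so the
   coefficients b n = sum of F(L) over [L] = n of its logarithmic derivative are bounded. But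
   b n is at least the number of subgroups of index n, up to a constant, and that number is
   unbounded: if S 0 < ... < S h is the series of the definition of the Hirsch length, then S h
   is generated by A = S (h - 1) and an element t of infinite order modulo A, and A maps onto the
   integers by some f. For each n some power u of t preserves f modulo n, and the subgroups
   {a u^k. a in A, f a = i k mod n} with 0 <= i < n are distinct and have the same index. *)

theory Submission
  imports
    Defs
    "HOL-Complex_Analysis.Complex_Analysis"
    "HOL-Computational_Algebra.Fundamental_Theorem_Algebra"
    "Jordan_Normal_Form.Determinant"
begin

section \<open>A polynomial that is small on a truncated disc\<close>

text \<open>The link between the truncated disc and the Hankel matrices is the linear functional
  that sends \<open>X^i\<close> to the i-th coefficient. In the variable w = 1 / z it is a contour
  integral against f(1/w) / w, and the continuation lets the contour be moved into the truncated
  disc, so a polynomial that is small there has a small moment. Powers of one monic polynomial of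
  modulus less than 1 there, times monomials, supply a polynomial of each degree; the change of
  basis from the monomials is triangular and preserves the modulus of the Hankel determinants.
  Polynomial subgroup growth and vanishing growth rate serve to make the exponent of zeta_alpha
  converge in the unit disc. Hirsch length at least 2 provides a second cyclic factor, hence f,
  below the one of t. The obstacle is that the kernel of f need not be invariant under t; this is
  why f is used modulo n only, where finite generation of A leaves finitely many
  homomorphisms.\<close>

lemma Re_truncated_binomial:
  fixes w :: complex
  assumes "norm w = 1"
  shows "Re (cnj w ^ m * (\<Sum>j<m. of_nat ((2*m) choose j) * w ^ j))
           = (norm (1 + w) ^ (2*m) - real ((2*m) choose m)) / 2"
proof -
  let ?t = "\<lambda>j. of_nat ((2*m) choose j) * (cnj w ^ m * w ^ j)"
  have ww: "w * cnj w = 1"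
    using assms by (simp add: complex_norm_square[symmetric])
  have ww': "w ^ j * cnj w ^ j = 1" for j
    using ww by (metis power_mult_distrib power_one)
  have Re_sym: "Re (z + of_nat k + cnj z) = 2 * Re z + real k" for z k
    by simp
  \<comment> \<open>The coefficients of \<open>(1 + w) ^ (2*m)\<close> are symmetric and
    \<open>cnj w\<close> is the inverse of \<open>w\<close>, so terms symmetric about the middle are
    conjugate; those below the middle carry half of the real part of all but the middle one.\<close>
  have refl: "?t (2*m - j) = cnj (?t j)" if "j < m" for j
  proof -
    have 1: "w ^ (2*m - j) = w ^ m * w ^ (m - j)"
      using that by (simp add: mult_2 flip: power_add)
    have 2: "w ^ m = w ^ j * w ^ (m - j)"
      using that by (simp flip: power_add)
    have 3: "cnj w ^ m = cnj w ^ j * cnj w ^ (m - j)"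
      using that by (simp flip: power_add)
    have "cnj w ^ m * w ^ (2*m - j) = w ^ (m - j)"
      using 1 ww'[of m] by (simp add: algebra_simps)
    moreover have "w ^ m * cnj w ^ j = w ^ (m - j)"
      using 2 ww'[of j] by (simp add: algebra_simps)
    moreover have "(2*m) choose (2*m - j) = (2*m) choose j"
      using that binomial_symmetric[of j "2*m"] by simp
    ultimately show ?thesis by simp
  qed
  have "cnj w ^ m * (1 + w) ^ (2*m) = (cnj w * (1 + w) ^ 2) ^ m"
    by (simp add: power_mult_distrib power_mult)
  also have "cnj w * (1 + w) ^ 2 = (1 + w) * (1 + cnj w)"
    using ww by (simp add: power2_eq_square algebra_simps)
  also have "\<dots> = of_real (norm (1 + w) ^ 2)"
    using complex_norm_square[of "1 + w"] by simp
  finally have A: "cnj w ^ m * (1 + w) ^ (2*m) = of_real (norm (1 + w) ^ (2*m))"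
    by (simp add: power_mult)
  have "cnj w ^ m * (1 + w) ^ (2*m) = (\<Sum>j\<le>2*m. ?t j)"
    unfolding add.commute[of 1 w] binomial_ring sum_distrib_left
    by (intro sum.cong) (simp_all add: mult_ac)
  also have "{..2*m} = ({..<m} \<union> {m}) \<union> {m<..2*m}" by auto
  also have "sum ?t \<dots> = sum ?t {..<m} + ?t m + sum ?t {m<..2*m}"
    by (subst sum.union_disjoint) (auto simp: sum.union_disjoint)
  also have "sum ?t {m<..2*m} = (\<Sum>j<m. ?t (2*m - j))"
    by (rule sum.reindex_bij_witness[of _ "\<lambda>j. 2*m - j" "\<lambda>j. 2*m - j"]) auto
  also have "\<dots> = cnj (sum ?t {..<m})"
    unfolding cnj_sum by (rule sum.cong) (use refl in auto)
  also have "?t m = of_nat ((2*m) choose m)"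
    using ww'[of m] by (simp add: mult.commute)
  finally have "complex_of_real (norm (1 + w) ^ (2*m))
      = sum ?t {..<m} + of_nat ((2*m) choose m) + cnj (sum ?t {..<m})"
    unfolding A .
  then have "norm (1 + w) ^ (2*m)
      = Re (sum ?t {..<m} + of_nat ((2*m) choose m) + cnj (sum ?t {..<m}))"
    by (metis Re_complex_of_real)
  also have "\<dots> = 2 * Re (sum ?t {..<m}) + real ((2*m) choose m)"
    by (rule Re_sym)
  finally have "norm (1 + w) ^ (2*m) = 2 * Re (sum ?t {..<m}) + real ((2*m) choose m)" .
  moreover have "cnj w ^ m * (\<Sum>j<m. of_nat ((2*m) choose j) * w ^ j) = sum ?t {..<m}"
    by (simp add: sum_distrib_left algebra_simps)
  ultimately show ?thesis by simp
qed

text \<open>The central coefficient is at least \<open>4 ^ m / (2 * m)\<close>, and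
  \<open>2 + 2 * c < 4\<close>. The left side bounds \<open>norm (1 + w) ^ (2*m)\<close> on the arc
  \<open>Re w \<le> c\<close> of the unit circle.\<close>

lemma central_binomial_gt_power:
  fixes c :: real
  assumes "0 \<le> c" "c < 1"
  shows "\<exists>m>0. (2 + 2 * c) ^ m < real ((2*m) choose m)"
proof -
  define x where "x = (2 + 2 * c) / 4"
  have x: "0 < x" "x < 1" using assms by (auto simp: x_def)
  have "(\<lambda>m. real m * x ^ m) \<longlonglongrightarrow> 0"
    using x powser_times_n_limit_0[of x] by simp
  then have "eventually (\<lambda>m. real m * x ^ m < 1/2) sequentially"
    by (rule order_tendstoD) simp
  moreover have "eventually (\<lambda>m. m > (0::nat)) sequentially"
    by (rule eventually_gt_at_top)
  ultimately have "eventually (\<lambda>m. real m * x ^ m < 1/2 \<and> m > 0) sequentially"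
    by eventually_elim simp
  then obtain m where m: "real m * x ^ m < 1/2" "m > 0"
    using eventually_happens'[OF sequentially_bot] by fastforce
  have "(2 + 2 * c) ^ m = 4 ^ m * x ^ m"
    by (simp add: x_def power_divide)
  also have "\<dots> < 4 ^ m / (2 * real m)"
    using m by (simp add: field_simps)
  also have "\<dots> \<le> real ((2*m) choose m)"
    using central_binomial_lower_bound[OF m(2)] by simp
  finally show ?thesis using m by blast
qed

lemma norm_diff_power2_complex:
  fixes a b :: complex
  shows "norm (a - b) ^ 2 = norm a ^ 2 - 2 * Re (cnj a * b) + norm b ^ 2"
  unfolding cmod_power2 by (simp add: power2_eq_square algebra_simps)

text \<open>The truncated disc has capacity less than \<open>1\<close>: the first-order perturbation
  \<open>w ^ m - d * T w\<close> of \<open>w ^ m\<close> decreases the modulus wherever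
  \<open>Re (cnj w ^ m * T w) > 0\<close>, and \<open>T\<close> below is chosen so that this happens on the
  remaining part of the unit circle.\<close>

lemma truncated_disc_monic_poly:
  fixes c :: real
  assumes c: "0 \<le> c" "c < 1"
  obtains q :: "complex poly" and R r :: real
  where "lead_coeff q = 1" "degree q > 0" "1 < R" "0 < r" "r < 1"
    "\<And>w. norm w \<le> R \<Longrightarrow> Re w \<le> c \<Longrightarrow> norm (poly q w) \<le> r"
proof -
  obtain m where m: "m > 0" "(2 + 2 * c) ^ m < real ((2*m) choose m)"
    using central_binomial_gt_power[OF c] by blast
  define \<eta> where "\<eta> = real ((2*m) choose m) - (2 + 2 * c) ^ m"
  have \<eta>: "\<eta> > 0" using m by (simp add: \<eta>_def)
  \<comment> \<open>The factor \<open>-2\<close> cancels the half in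
    \<open>Re_truncated_binomial\<close> and fixes the sign: on the unit circle \<open>u w\<close>
    below is the central coefficient minus \<open>norm (1 + w) ^ (2*m)\<close>.\<close>
  define T :: "complex poly" where "T = (\<Sum>j<m. monom (- 2 * of_nat ((2*m) choose j)) j)"
  have T: "poly T w = - 2 * (\<Sum>j<m. of_nat ((2*m) choose j) * w ^ j)" for w
    by (simp add: T_def poly_sum poly_monom sum_distrib_left algebra_simps)
  have degT: "degree T < m"
    unfolding T_def by (rule degree_sum_less) (use m in \<open>auto intro: le_less_trans[OF degree_monom_le]\<close>)
  define u where "u = (\<lambda>w. Re (cnj w ^ m * poly T w))"
  have cont_u: "continuous_on A u" for A
    unfolding u_def by (intro continuous_intros)
  have u_ge: "u w \<ge> \<eta>" if "norm w = 1" "Re w \<le> c" for w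
  proof -
    have "norm (1 + w) ^ 2 = 1 + 2 * Re w + norm w ^ 2"
      unfolding cmod_power2 by (simp add: power2_eq_square algebra_simps)
    then have "norm (1 + w) ^ 2 = 2 + 2 * Re w"
      using that(1) by simp
    then have "norm (1 + w) ^ (2*m) = (2 + 2 * Re w) ^ m"
      by (simp add: power_mult)
    also have "\<dots> \<le> (2 + 2 * c) ^ m"
      using that abs_Re_le_cmod[of w] by (intro power_mono) auto
    finally have "norm (1 + w) ^ (2*m) \<le> (2 + 2 * c) ^ m" .
    moreover have "u w = real ((2*m) choose m) - norm (1 + w) ^ (2*m)"
      using Re_truncated_binomial[OF that(1), of m]
      by (simp add: u_def T algebra_simps)
    ultimately show ?thesis by (simp add: \<eta>_def)
  qed
  define K where "K = cball (0::complex) 1 \<inter> {w. Re w \<le> c}"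
  have K: "compact K"
    unfolding K_def by (intro compact_Int_closed compact_cball closed_halfspace_Re_le)
  have K0: "0 \<in> K" using c by (simp add: K_def)
  \<comment> \<open>Where \<open>K\<close> meets the unit circle, \<open>u w \<ge> \<eta>\<close>,
    so by compactness the points with \<open>u w \<le> \<eta>/2\<close> stay away from the circle.
    At these \<open>w ^ m\<close> is already small; at the others the linear term of the
    perturbation gains.\<close>
  have "\<exists>\<rho><1. 0 \<le> \<rho> \<and> (\<forall>w\<in>K. u w \<le> \<eta>/2 \<longrightarrow> norm w \<le> \<rho>)"
  proof (cases "K \<inter> {w. u w \<le> \<eta>/2} = {}")
    case True
    then show ?thesis by (intro exI[of _ 0]) auto
  next
    case False
    have "closed {w. u w \<le> \<eta>/2}"
      using cont_u by (intro closed_Collect_le continuous_intros) auto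
    then have "compact (K \<inter> {w. u w \<le> \<eta>/2})"
      using K by (rule compact_Int_closed[rotated])
    from continuous_attains_sup[OF this False continuous_on_norm_id]
    obtain x where x: "x \<in> K" "u x \<le> \<eta>/2" "\<And>w. w \<in> K \<Longrightarrow> u w \<le> \<eta>/2 \<Longrightarrow> norm w \<le> norm x"
      by auto
    have "norm x \<noteq> 1" using u_ge[of x] x \<eta> by (auto simp: K_def)
    moreover have "norm x \<le> 1" using x by (simp add: K_def)
    ultimately show ?thesis using x by (intro exI[of _ "norm x"]) auto
  qed
  then obtain \<rho> where \<rho>: "\<rho> < 1" "0 \<le> \<rho>" "\<And>w. w \<in> K \<Longrightarrow> u w \<le> \<eta>/2 \<Longrightarrow> norm w \<le> \<rho>"
    by blast
  have "bounded (poly T ` K)"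
    by (intro compact_imp_bounded compact_continuous_image K continuous_intros)
  then obtain M where M: "M > 0" "\<And>w. w \<in> K \<Longrightarrow> norm (poly T w) \<le> M"
    unfolding bounded_pos by blast
  define \<sigma> where "\<sigma> = 1 - \<rho> ^ (2*m)"
  have \<sigma>: "\<sigma> > 0"
    using \<rho> m by (simp add: \<sigma>_def power_less_one_iff)
  \<comment> \<open>With \<open>1/M\<close> the quadratic term is at most \<open>d * M\<close>, with
    \<open>\<eta> / (2 * M^2)\<close> at most half of the linear gain \<open>d * \<eta>\<close>, and
    \<open>\<sigma> / (4 * M)\<close> keeps the total error \<open>3 * (d * M)\<close> below the
    room \<open>\<sigma>\<close> left by \<open>\<rho> ^ (2*m)\<close>.\<close>
  define d where "d = min (1/M) (min (\<eta> / (2 * M^2)) (\<sigma> / (4 * M)))"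
  have d: "d > 0" "d * M \<le> 1" "d * M^2 \<le> \<eta>/2" "d * M \<le> \<sigma>/4"
  proof -
    have "d \<le> 1/M" "d \<le> \<eta> / (2 * M^2)" "d \<le> \<sigma> / (4 * M)"
      by (simp_all add: d_def)
    then have "d * M \<le> 1" "d * (2 * M^2) \<le> \<eta>" "d * (4 * M) \<le> \<sigma>"
      using M(1) by (simp_all add: pos_le_divide_eq)
    then show "d * M \<le> 1" "d * M^2 \<le> \<eta>/2" "d * M \<le> \<sigma>/4"
      by linarith+
    show "d > 0" using M(1) \<eta> \<sigma> by (simp add: d_def)
  qed
  define q where "q = monom 1 m - Polynomial.smult (of_real d) T"
  have dq: "degree q = m"
    unfolding q_def using degT
    using degree_add_eq_left[of "- Polynomial.smult (of_real d) T" "monom 1 m :: complex poly"]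
    by (simp add: degree_monom_eq le_less_trans[OF degree_smult_le])
  have lq: "lead_coeff q = 1"
    using degT dq by (simp add: q_def coeff_eq_0)
  have q_less: "norm (poly q w) < 1" if w: "w \<in> K" for w
  proof -
    have q: "norm (poly q w) ^ 2 = norm w ^ (2*m) - 2 * d * u w + d^2 * norm (poly T w) ^ 2"
    proof -
      have "cnj (w ^ m) * (of_real d * poly T w) = of_real d * (cnj w ^ m * poly T w)"
        by simp
      then have "Re (cnj (w ^ m) * (of_real d * poly T w)) = d * u w"
        by (simp only: u_def) simp
      moreover have "norm (w ^ m) ^ 2 = norm w ^ (2*m)"
        by (metis norm_power power_even_eq)
      ultimately show ?thesis
        using norm_diff_power2_complex[of "w^m" "of_real d * poly T w"]
        by (simp add: q_def poly_monom norm_mult power_mult_distrib)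
    qed
    have n1: "norm w \<le> 1" using w by (simp add: K_def)
    have n2: "norm (poly T w) ^ 2 \<le> M^2" using M(2)[OF w] by (intro power_mono) auto
    have nu: "- u w \<le> M"
    proof -
      have "- u w \<le> norm (cnj w ^ m * poly T w)"
        unfolding u_def by (meson abs_Re_le_cmod abs_le_D2)
      also have "\<dots> \<le> 1 * M"
        unfolding norm_mult norm_power complex_mod_cnj
        using n1 M(2)[OF w] by (intro mult_mono power_le_one) auto
      finally show ?thesis by simp
    qed
    have dT: "d^2 * norm (poly T w)^2 \<le> d * (d * M^2)"
      using d(1) n2 by (simp add: power2_eq_square mult_left_mono)
    have "norm (poly q w) ^ 2 < 1"
    proof (cases "u w \<le> \<eta>/2")
      case True
      have "norm w ^ (2*m) \<le> \<rho> ^ (2*m)"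
        using \<rho>(3)[OF w True] by (intro power_mono) auto
      moreover have "d * (- u w) \<le> d * M" using nu d(1) by (intro mult_left_mono) auto
      moreover have "d * (d * M^2) \<le> d * M"
        using mult_left_mono[OF d(2), of "d * M"] d(1) M(1) by (simp add: power2_eq_square algebra_simps)
      ultimately have "norm (poly q w) ^ 2 \<le> \<rho> ^ (2*m) + 3 * (d * M)"
        using q dT by simp
      also have "\<dots> \<le> (1 - \<sigma>) + 3 * (\<sigma> / 4)"
        using d(4) by (intro add_mono mult_left_mono) (simp_all add: \<sigma>_def)
      also have "\<dots> < 1" using \<sigma> by simp
      finally show ?thesis .
    next
      case False
      have "norm w ^ (2*m) \<le> 1" using n1 by (intro power_le_one) auto
      moreover have "d * (\<eta>/2) < d * u w" using False d(1) by (intro mult_strict_left_mono) auto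
      moreover have "d * (d * M^2) \<le> d * (\<eta>/2)" using d by (intro mult_left_mono) auto
      moreover have "d * (\<eta>/2) > 0" using d \<eta> by simp
      ultimately show ?thesis using q dT by linarith
    qed
    then show ?thesis by (simp add: power_less_one_iff abs_square_less_1)
  qed
  obtain w0 where w0: "w0 \<in> K" "\<And>w. w \<in> K \<Longrightarrow> norm (poly q w) \<le> norm (poly q w0)"
  proof -
    have "continuous_on K (\<lambda>w. norm (poly q w))"
      by (intro continuous_intros)
    then show ?thesis
      using continuous_attains_sup[of K "\<lambda>w. norm (poly q w)"] K K0 that by blast
  qed
  define r1 where "r1 = norm (poly q w0)"
  have r1: "r1 < 1" "0 \<le> r1" using q_less w0 by (auto simp: r1_def)
  have "uniformly_continuous_on (cball 0 2) (poly q)"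
    by (intro compact_uniformly_continuous continuous_intros) auto
  moreover have "(1 - r1)/2 > 0" using r1 by simp
  ultimately obtain \<delta> where \<delta>: "\<delta> > 0"
    "\<forall>x\<in>cball 0 2. \<forall>y\<in>cball 0 2. dist y x < \<delta> \<longrightarrow> dist (poly q y) (poly q x) < (1 - r1)/2"
    unfolding uniformly_continuous_on_def by blast
  define R where "R = 1 + min 1 (\<delta>/2)"
  show ?thesis
  proof (rule that[of q R "(1 + r1)/2"])
    fix w :: complex assume w: "norm w \<le> R" "Re w \<le> c"
    \<comment> \<open>A point slightly outside the unit disc is compared with its radial projection,
      which stays in \<open>K\<close> because \<open>c \<ge> 0\<close>: division by
      \<open>norm w > 1\<close> cannot leave the real part above \<open>c\<close>.\<close>
    define w' where "w' = (if norm w \<le> 1 then w else sgn w)"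
    have w': "w' \<in> K"
    proof (cases "norm w \<le> 1")
      case False
      then have "c * 1 \<le> c * norm w" using c(1) by (intro mult_left_mono) auto
      then have "Re w / norm w \<le> c"
        using w(2) False by (subst pos_divide_le_eq) auto
      then show ?thesis using False by (auto simp: w'_def K_def sgn_eq norm_divide)
    qed (use w in \<open>auto simp: w'_def K_def\<close>)
    have "dist w' w < \<delta>"
    proof (cases "norm w \<le> 1")
      case False
      then have w0: "w \<noteq> 0" by auto
      then have "w - sgn w = of_real (norm w - 1) * sgn w"
        by (simp add: sgn_eq field_simps)
      then have "norm (w - sgn w) = norm w - 1"
        using False w0 by (simp add: norm_mult norm_sgn del: of_real_diff)
      then show ?thesis using False w \<delta>(1) by (auto simp: w'_def dist_norm norm_minus_commute R_def)
    qed (use \<delta> in \<open>auto simp: w'_def\<close>)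
    moreover have "w \<in> cball 0 2" using w by (simp add: R_def)
    moreover have "w' \<in> cball 0 2" using w' by (simp add: K_def)
    ultimately have "dist (poly q w) (poly q w') < (1 - r1)/2"
      using \<delta>(2) by (simp add: dist_commute)
    then have "norm (poly q w) < norm (poly q w') + (1 - r1)/2"
      using norm_triangle_ineq2[of "poly q w" "poly q w'"] unfolding dist_norm by linarith
    also have "norm (poly q w') \<le> r1" using w0(2)[OF w'] by (simp add: r1_def)
    finally show "norm (poly q w) \<le> (1 + r1)/2" by (simp add: field_simps)
  qed (use lq dq m r1 \<delta> in \<open>auto simp: R_def\<close>)
qed

section \<open>Moments and Hankel matrices\<close>

text \<open>The linear functional sending \<open>X^i\<close> to \<open>a i\<close>; the Hankel
  matrix is the Gram matrix of the bilinear form \<open>moment a (p * q)\<close> on the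
  monomials.\<close>

definition moment :: "(nat \<Rightarrow> 'a::comm_semiring_1) \<Rightarrow> 'a poly \<Rightarrow> 'a" where
  "moment a p = (\<Sum>i\<le>degree p. coeff p i * a i)"

lemma moment_eq:
  assumes "degree p \<le> n"
  shows "moment a p = (\<Sum>i\<le>n. coeff p i * a i)"
  unfolding moment_def
  by (rule sum.mono_neutral_left) (use assms in \<open>auto simp: coeff_eq_0\<close>)

lemma moment_0 [simp]: "moment a 0 = 0"
  by (simp add: moment_def)

lemma moment_add: "moment a (p + q) = moment a p + moment a q"
proof -
  let ?n = "max (degree p) (degree q)"
  show ?thesis
    using moment_eq[of "p + q" ?n a] moment_eq[of p ?n a] moment_eq[of q ?n a]
    by (simp add: degree_add_le_max sum.distrib algebra_simps)
qed

lemma moment_smult: "moment a (Polynomial.smult c p) = c * moment a p"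
  using moment_eq[of "Polynomial.smult c p" "degree p" a] moment_eq[of p "degree p" a]
  by (simp add: degree_smult_le sum_distrib_left mult.assoc)

lemma moment_sum: "moment a (sum f A) = (\<Sum>x\<in>A. moment a (f x))"
  by (induction A rule: infinite_finite_induct) (auto simp: moment_add)

lemma moment_monom: "moment a (monom c n) = c * a n"
  using moment_eq[OF degree_monom_le[of c n], of a]
  by (simp add: if_distrib[of "\<lambda>x. x * _"] cong: if_cong)

lemma moment_mult_monom_eq_0:
  assumes "\<And>j. j < m \<Longrightarrow> moment a (b * monom 1 j) = 0" "degree s < m"
  shows "moment a (b * s) = 0"
proof -
  have "b * s = (\<Sum>i\<le>degree s. Polynomial.smult (coeff s i) (b * monom 1 i))"
  proof -
    have "b * s = (\<Sum>i\<le>degree s. b * monom (coeff s i) i)"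
      by (simp add: poly_as_sum_of_monoms flip: sum_distrib_left)
    also have "\<dots> = (\<Sum>i\<le>degree s. Polynomial.smult (coeff s i) (b * monom 1 i))"
      by (simp add: smult_monom flip: mult_smult_right)
    finally show ?thesis .
  qed
  then have "moment a (b * s) = (\<Sum>i\<le>degree s. coeff s i * moment a (b * monom 1 i))"
    by (simp add: moment_sum moment_smult)
  also have "\<dots> = 0"
    by (rule sum.neutral) (use assms in auto)
  finally show ?thesis .
qed

text \<open>The Hankel matrix \<open>(a (i + j))\<close> with \<open>i, j < n\<close> is singular; its kernel vectors are
  encoded as polynomials of degree less than \<open>n\<close>.\<close>

definition hankel_singular :: "(nat \<Rightarrow> 'a::comm_semiring_1) \<Rightarrow> nat \<Rightarrow> bool" where
  "hankel_singular a n \<longleftrightarrow> (\<exists>c. c \<noteq> 0 \<and> degree c < n \<and> (\<forall>j<n. moment a (c * monom 1 j) = 0))"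

text \<open>The orthogonal polynomial \<open>b\<close> of the largest nonsingular size annihilates all powers: at
  the first power \<open>m\<close> where it did not, division by \<open>b\<close> of a kernel vector for size \<open>m + 1\<close>
  would leave no remainder and a quotient that pairs with \<open>m\<close> only.\<close>

lemma kronecker_hankel:
  fixes a :: "nat \<Rightarrow> 'a::field"
  assumes sing: "\<And>n. n > p \<Longrightarrow> hankel_singular a n"
    and b: "degree b = p" "lead_coeff b = 1" "\<And>j. j < p \<Longrightarrow> moment a (b * monom 1 j) = 0"
    and nonsing: "\<not> hankel_singular a p"
  shows "moment a (b * monom 1 m) = 0"
proof (induction m rule: less_induct)
  case (less m)
  show ?case
  proof (cases "m < p")
    case False
    from sing[of "Suc m"] False obtain c where
      c: "c \<noteq> 0" "degree c \<le> m" "\<And>j. j \<le> m \<Longrightarrow> moment a (c * monom 1 j) = 0"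
      by (auto simp: hankel_singular_def less_Suc_eq_le)
    define s t where "s = c div b" and "t = c mod b"
    have b0: "b \<noteq> 0" using b(2) by auto
    have cst: "c = b * s + t" by (simp add: s_def t_def)
    have degt: "t = 0 \<or> degree t < p"
      using degree_mod_less[OF b0, of c] by (simp add: t_def b)
    have degs: "degree s + p \<le> m" if "s \<noteq> 0"
    proof -
      have "degree (b * s) = p + degree s" using b0 that by (simp add: degree_mult_eq b)
      moreover have "degree c = degree (b * s)"
      proof (cases "t = 0")
        case False
        then have "degree t < degree (b * s)" using degt calculation by simp
        then show ?thesis by (simp add: cst degree_add_eq_left)
      qed (simp add: cst)
      ultimately show ?thesis using c(2) by simp
    qed
    \<comment> \<open>For \<open>j < p\<close> the polynomial \<open>s * monom 1 j\<close> has
      degree below \<open>m\<close>, so the induction hypothesis annihilates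
      \<open>b * s * monom 1 j\<close>; subtracted from \<open>c\<close> this makes \<open>t\<close>
      a kernel vector for size \<open>p\<close>.\<close>
    have "t = 0"
    proof (rule ccontr)
      assume t0: "t \<noteq> 0"
      have "moment a (t * monom 1 j) = 0" if "j < p" for j
      proof -
        have "moment a (b * (s * monom 1 j)) = 0"
        proof (cases "s = 0")
          case False
          show ?thesis
          proof (rule moment_mult_monom_eq_0)
            show "degree (s * monom 1 j) < m"
              using degs[OF False] that False by (simp add: degree_mult_eq degree_monom_eq)
          qed (use less in auto)
        qed simp
        moreover have "moment a (c * monom 1 j) = 0" using c(3)[of j] that False by simp
        ultimately show ?thesis
          by (simp add: cst moment_add algebra_simps)
      qed
      then show False using nonsing t0 degt by (auto simp: hankel_singular_def)
    qed
    then have cs: "c = b * s" and s0: "s \<noteq> 0" using c(1) cst by auto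
    define d where "d = degree s"
    have dm: "d \<le> m" using degs[OF s0] by (simp add: d_def)
    \<comment> \<open>The factor \<open>monom 1 (m - d)\<close> lifts the top term of
      \<open>s\<close> exactly to degree \<open>m\<close> and the rest to lower degrees, which the
      induction hypothesis covers.\<close>
    define s' where "s' = s - monom (lead_coeff s) d"
    have s': "s = s' + monom (lead_coeff s) d" by (simp add: s'_def)
    have "moment a (b * (s' * monom 1 (m - d))) = 0"
    proof (cases "s' = 0")
      case False
      have "coeff s' i = 0" if "i \<ge> d" for i
        using that by (cases "i = d") (auto simp: s'_def d_def coeff_eq_0)
      then have "degree s' < d"
        using False by (intro degree_lessI) auto
      moreover have "degree (s' * monom 1 (m - d)) \<le> degree s' + (m - d)"
        using degree_mult_le[of s' "monom 1 (m - d)"] degree_monom_le[of "1::'a" "m - d"] by linarith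
      ultimately have "degree (s' * monom 1 (m - d)) < m"
        using dm by linarith
      from moment_mult_monom_eq_0[OF less this] show ?thesis
        by simp
    qed simp
    moreover have "moment a (b * (monom (lead_coeff s) d * monom 1 (m - d))) = lead_coeff s * moment a (b * monom 1 m)"
    proof -
      have "monom (lead_coeff s) d * monom 1 (m - d) = Polynomial.smult (lead_coeff s) (monom 1 m)"
        using dm by (simp add: mult_monom smult_monom)
      then show ?thesis by (simp only: mult_smult_right moment_smult)
    qed
    moreover have "moment a (c * monom 1 (m - d)) = 0" using c(3) by simp
    moreover have "c * monom 1 (m - d) = b * (s' * monom 1 (m - d)) + b * (monom (lead_coeff s) d * monom 1 (m - d))"
      by (subst cs, subst s') (simp add: algebra_simps)
    ultimately have "lead_coeff s * moment a (b * monom 1 m) = 0"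
      by (simp add: moment_add)
    then show ?thesis using s0 by simp
  qed (rule b(3))
qed

text \<open>The vanishing moments are a linear recurrence for \<open>a\<close>. Multiplying the
  generating series by the reversal \<open>B\<close> of \<open>b\<close> evaluates this recurrence
  in each coefficient from \<open>degree b\<close> on.\<close>

lemma fps_rational_of_recurrence:
  fixes a :: "nat \<Rightarrow> 'a::field"
  assumes "b \<noteq> 0" "\<And>j. moment a (b * monom 1 j) = 0"
  shows "\<exists>B P. B \<noteq> 0 \<and> Abs_fps a * fps_of_poly B = fps_of_poly P"
proof -
  define p where "p = degree b"
  define B where "B = (\<Sum>k\<le>p. monom (coeff b (p - k)) k)"
  have B: "coeff B k = (if k \<le> p then coeff b (p - k) else 0)" for k
    by (simp add: B_def coeff_sum)
  have "coeff B 0 \<noteq> 0" using assms(1) by (simp add: B p_def)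
  then have B0: "B \<noteq> 0" by auto
  have zero: "fps_nth (Abs_fps a * fps_of_poly B) n = 0" if "n \<ge> p" for n
  proof -
    have "moment a (b * monom 1 (n - p)) = moment a (\<Sum>i\<le>p. monom (coeff b i) (i + (n - p)))"
      by (subst poly_as_sum_of_monoms[of b, symmetric])
        (simp add: sum_distrib_right mult_monom p_def)
    also have "\<dots> = (\<Sum>i\<le>p. coeff b i * a (i + (n - p)))"
      by (simp add: moment_sum moment_monom)
    also have "\<dots> = (\<Sum>k\<le>p. coeff b (p - k) * a (n - k))"
      by (rule sum.reindex_bij_witness[of _ "\<lambda>k. p - k" "\<lambda>k. p - k"])
        (use that in \<open>auto simp: add.commute\<close>)
    also have "\<dots> = (\<Sum>k\<le>n. coeff B k * a (n - k))"
      by (rule sum.mono_neutral_cong_left) (use that in \<open>auto simp: B\<close>)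
    also have "\<dots> = fps_nth (fps_of_poly B * Abs_fps a) n"
      by (simp add: fps_mult_nth atLeast0AtMost)
    finally show ?thesis using assms(2) by (simp add: mult.commute)
  qed
  have "Abs_fps a * fps_of_poly B = fps_of_poly (\<Sum>k<p. monom (fps_nth (Abs_fps a * fps_of_poly B) k) k)"
    by (rule fps_ext) (use zero in \<open>auto simp: coeff_sum not_less\<close>)
  then show ?thesis using B0 by blast
qed

section \<open>Hankel determinants under decaying moments\<close>

definition hankel_mat :: "(nat \<Rightarrow> 'a) \<Rightarrow> nat \<Rightarrow> 'a mat" where
  "hankel_mat a n = Matrix.mat n n (\<lambda>(i, j). a (i + j))"

lemma hankel_singular_if_det_0:
  fixes a :: "nat \<Rightarrow> 'a::field"
  assumes "Determinant.det (hankel_mat a n) = 0"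
  shows "hankel_singular a n"
proof -
  have H: "hankel_mat a n \<in> carrier_mat n n" by (simp add: hankel_mat_def)
  from assms det_0_iff_vec_prod_zero[OF H] obtain v where
    v: "v \<in> carrier_vec n" "v \<noteq> 0\<^sub>v n" "hankel_mat a n *\<^sub>v v = 0\<^sub>v n" by blast
  define c where "c = (\<Sum>i<n. monom (vec_index v i) i)"
  have coeff_c: "coeff c i = (if i < n then vec_index v i else 0)" for i
    by (simp add: c_def coeff_sum)
  have "\<exists>i<n. vec_index v i \<noteq> 0"
    using v(1,2) by (metis carrier_vecD eq_vecI index_zero_vec)
  then obtain i where i: "i < n" "vec_index v i \<noteq> 0" by blast
  then have c0: "c \<noteq> 0" using coeff_c[of i] by auto
  have "degree c < n"
    using c0 by (intro degree_lessI) (auto simp: coeff_c)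
  moreover have "moment a (c * monom 1 j) = 0" if "j < n" for j
  proof -
    have "moment a (c * monom 1 j) = (\<Sum>i<n. vec_index v i * a (i + j))"
      by (simp add: c_def sum_distrib_right mult_monom moment_sum moment_monom)
    also have "\<dots> = vec_index (hankel_mat a n *\<^sub>v v) j"
      using that v(1)
      by (simp add: hankel_mat_def scalar_prod_def lessThan_atLeast0 add.commute mult.commute)
    also have "\<dots> = 0" using that v(3) by simp
    finally show ?thesis .
  qed
  ultimately show ?thesis using c0 unfolding hankel_singular_def by blast
qed

lemma moment_mult_eq_sum:
  assumes "degree p < n" "degree q < n"
  shows "moment a (p * q) = (\<Sum>k<n. \<Sum>l<n. coeff p k * a (k + l) * coeff q l)"
proof -
  have rep: "r = (\<Sum>k<n. monom (coeff r k) k)" if "degree r < n" for r :: "'a poly"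
    by (rule poly_eqI) (use that in \<open>auto simp: coeff_sum coeff_eq_0\<close>)
  have "p * q = (\<Sum>k<n. monom (coeff p k) k) * (\<Sum>l<n. monom (coeff q l) l)"
    by (rule arg_cong2[of _ _ _ _ "(*)", OF rep[OF assms(1)] rep[OF assms(2)]])
  also have "\<dots> = (\<Sum>k<n. \<Sum>l<n. monom (coeff p k * coeff q l) (k + l))"
    by (simp add: sum_product mult_monom)
  finally have "p * q = (\<Sum>k<n. \<Sum>l<n. monom (coeff p k * coeff q l) (k + l))" .
  then show ?thesis
    by (simp add: moment_sum moment_monom mult_ac)
qed

text \<open>A change of basis from the monomials to the \<open>p i\<close> turns the Hankel matrix
  into the matrix of moments. Its matrix \<open>P\<close> is triangular with diagonal entries of
  norm 1, so the determinants have equal norm. Each of the \<open>fact n\<close> Leibniz terms is at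
  most \<open>C ^ n * s ^ (n * (n - 1))\<close>, as the exponents \<open>i + \<sigma> i\<close> add
  up to \<open>n * (n - 1)\<close>.\<close>

lemma norm_det_hankel_le:
  fixes a :: "nat \<Rightarrow> 'a::{real_normed_field}"
  assumes deg: "\<And>i. degree (p i) = i" and lead: "\<And>i. norm (lead_coeff (p i)) = 1"
    and bound: "\<And>i j. norm (moment a (p i * p j)) \<le> C * s ^ (i + j)"
    and "0 \<le> s" "0 \<le> C"
  shows "norm (Determinant.det (hankel_mat a n)) \<le> (real n * (C * s ^ (n - 1))) ^ n"
proof -
  define P where "P = Matrix.mat n n (\<lambda>(i, k). coeff (p i) k)"
  define M where "M = Matrix.mat n n (\<lambda>(i, j). moment a (p i * p j))"
  have P: "P \<in> carrier_mat n n" and H: "hankel_mat a n \<in> carrier_mat n n"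
    and M: "M \<in> carrier_mat n n"
    by (simp_all add: P_def hankel_mat_def M_def)
  have "M = P * hankel_mat a n * transpose_mat P"
  proof (rule eq_matI)
    fix i j assume "i < dim_row (P * hankel_mat a n * transpose_mat P)"
      "j < dim_col (P * hankel_mat a n * transpose_mat P)"
    then have ij: "i < n" "j < n" using P by simp_all
    have "M $$ (i, j) = (\<Sum>k<n. \<Sum>l<n. coeff (p i) k * a (k + l) * coeff (p j) l)"
      using ij by (simp add: M_def moment_mult_eq_sum deg)
    also have "\<dots> = (\<Sum>l<n. (\<Sum>k<n. coeff (p i) k * a (k + l)) * coeff (p j) l)"
      unfolding sum_distrib_right by (rule sum.swap)
    also have "\<dots> = (P * hankel_mat a n * transpose_mat P) $$ (i, j)"
      using ij by (simp add: P_def hankel_mat_def scalar_prod_def lessThan_atLeast0)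
    finally show "M $$ (i, j) = (P * hankel_mat a n * transpose_mat P) $$ (i, j)" .
  qed (use P M in auto)
  then have "Determinant.det M = Determinant.det P * Determinant.det (hankel_mat a n) * Determinant.det P"
    using P H by (simp add: Determinant.det_mult[of _ n] Determinant.det_transpose[of _ n])
  moreover have "norm (Determinant.det P) = 1"
  proof -
    have "Determinant.det P = prod_list (diag_mat P)"
      by (rule Determinant.det_lower_triangular[OF _ P]) (auto simp: P_def deg coeff_eq_0)
    also have "\<dots> = (\<Prod>i<n. lead_coeff (p i))"
      by (simp add: prod_list_diag_prod P_def deg lessThan_atLeast0)
    finally show ?thesis using lead by (simp flip: prod_norm)
  qed
  ultimately have "norm (Determinant.det (hankel_mat a n)) = norm (Determinant.det M)"
    by (simp add: norm_mult)
  also have "\<dots> \<le> (\<Sum>\<sigma>\<in>{\<sigma>. \<sigma> permutes {0..<n}}. (C * s ^ (n - 1)) ^ n)"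
    unfolding Determinant.det_def'[OF M]
  proof (rule sum_norm_le)
    fix \<sigma> assume "\<sigma> \<in> {\<sigma>. \<sigma> permutes {0..<n}}"
    then have \<sigma>: "\<sigma> permutes {0..<n}" by simp
    have lt: "\<sigma> i < n" if "i < n" for i using permutes_in_image[OF \<sigma>, of i] that by simp
    have "norm (signof \<sigma> * (\<Prod>i = 0..<n. M $$ (i, \<sigma> i)) :: 'a) = (\<Prod>i = 0..<n. norm (M $$ (i, \<sigma> i)))"
      by (simp add: norm_mult sign_def flip: prod_norm)
    also have "\<dots> \<le> (\<Prod>i = 0..<n. C * (s ^ i * s ^ \<sigma> i))"
      using lt bound by (intro prod_mono) (auto simp: M_def power_add)
    also have "\<dots> = C ^ n * ((\<Prod>i = 0..<n. s ^ i) * (\<Prod>i = 0..<n. s ^ \<sigma> i))"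
      by (simp add: prod.distrib)
    also have "(\<Prod>i = 0..<n. s ^ \<sigma> i) = (\<Prod>i = 0..<n. s ^ i)"
      using prod.permute[OF \<sigma>, of "\<lambda>i. s ^ i"] by (simp add: o_def)
    also have "(\<Prod>i = 0..<n. s ^ i) * (\<Prod>i = 0..<n. s ^ i) = (s ^ (n - 1)) ^ n"
    proof -
      have "(\<Prod>i = 0..<n. s ^ i) * (\<Prod>i = 0..<n. s ^ i) = s ^ (2 * (\<Sum>i = 0..<n. i))"
        by (simp add: power_sum[symmetric] power_add[symmetric] mult_2)
      also have "2 * (\<Sum>i = 0..<n. i) = (n - 1) * n"
      proof (induction n)
        case (Suc n)
        then show ?case by (cases n) auto
      qed simp
      finally show ?thesis by (simp add: power_mult)
    qed
    finally show "norm (signof \<sigma> * (\<Prod>i = 0..<n. M $$ (i, \<sigma> i)) :: 'a) \<le> (C * s ^ (n - 1)) ^ n"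
      by (simp add: power_mult_distrib)
  qed
  also have "\<dots> = fact n * (C * s ^ (n - 1)) ^ n"
    by (simp add: card_permutations[of "{0..<n}" n])
  also have "\<dots> \<le> real n ^ n * (C * s ^ (n - 1)) ^ n"
    using assms fact_le_power[of n, where 'a = real] by (intro mult_right_mono zero_le_power) auto
  finally show ?thesis by (simp add: power_mult_distrib)
qed

lemma eventually_hankel_singular:
  fixes a :: "nat \<Rightarrow> 'a::real_normed_field"
  assumes int: "\<And>n. a n \<in> \<int>"
    and deg: "\<And>i. degree (p i) = i" and lead: "\<And>i. norm (lead_coeff (p i)) = 1"
    and bound: "\<And>i j. norm (moment a (p i * p j)) \<le> C * s ^ (i + j)"
    and s: "0 < s" "s < 1"
  shows "eventually (hankel_singular a) sequentially"
proof -
  have C: "0 \<le> C" using order_trans[OF norm_ge_zero bound[of 0 0]] by simp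
  have "(\<lambda>n. real n * s ^ n) \<longlonglongrightarrow> 0"
    using s powser_times_n_limit_0[of s] by simp
  \<comment> \<open>The factor \<open>1 / s\<close> makes up for the exponent \<open>n - 1\<close>
    in the determinant bound, which is below 1 as soon as its base is.\<close>
  then have "(\<lambda>n. C / s * (real n * s ^ n)) \<longlonglongrightarrow> 0"
    by (rule tendsto_mult_right_zero)
  then have "eventually (\<lambda>n. C / s * (real n * s ^ n) < 1) sequentially"
    by (rule order_tendstoD) simp
  then show ?thesis
    using eventually_gt_at_top[of 0]
  proof eventually_elim
    case (elim n)
    have "C / s * (real n * s ^ n) = real n * (C * s ^ (n - 1))"
      using elim(2) s(1) by (cases n) auto
    then have lt1: "real n * (C * s ^ (n - 1)) < 1" using elim(1) by simp
    have "norm (Determinant.det (hankel_mat a n)) \<le> (real n * (C * s ^ (n - 1))) ^ n"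
      using s C by (intro norm_det_hankel_le[OF deg lead bound]) auto
    also have "\<dots> < 1"
      using lt1 C s elim(2) by (intro power_less_one_iff[THEN iffD2]) auto
    finally have "norm (Determinant.det (hankel_mat a n)) < 1" .
    moreover have "Determinant.det (hankel_mat a n) \<in> \<int>"
      unfolding Determinant.det_def hankel_mat_def
      using int by (auto intro!: Ints_sum Ints_mult Ints_prod simp: sign_def dest: permutes_in_image)
    ultimately have "Determinant.det (hankel_mat a n) = 0"
      by (elim Ints_cases) (auto simp flip: of_int_abs)
    then show ?case by (rule hankel_singular_if_det_0)
  qed
qed

section \<open>The Polya--Carlson theorem\<close>

lemma one_less_normD:
  fixes w :: complex
  assumes "1 < norm w"
  shows "w \<noteq> 0" "norm (1 / w) < 1"
proof -
  show "w \<noteq> 0" using assms by auto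
  have "1 / norm w < 1" using assms by (subst divide_less_eq_1_pos) linarith+
  then show "norm (1 / w) < 1" by (simp add: norm_divide)
qed

lemma holomorphic_on_eval_fps_unit_ball:
  fixes f :: "complex fps"
  assumes "fps_conv_radius f \<ge> 1"
  shows "eval_fps f holomorphic_on ball 0 1"
proof (rule holomorphic_on_eval_fps, rule subsetI)
  fix z :: complex assume "z \<in> ball 0 1"
  then have "ereal (norm z) < 1" by simp
  also note assms
  finally show "z \<in> eball 0 (fps_conv_radius f)" by (simp add: in_eball_iff)
qed

lemma eval_fps_split_shift:
  fixes f :: "complex fps"
  assumes "ereal (norm z) < fps_conv_radius f"
  shows "eval_fps f z = (\<Sum>k\<le>n. fps_nth f k * z ^ k) + z ^ Suc n * eval_fps (fps_shift (Suc n) f) z"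
proof -
  have s: "summable (\<lambda>k. fps_nth f k * z ^ k)"
    using assms by (rule summable_fps)
  have "eval_fps f z = (\<Sum>k. fps_nth f (k + Suc n) * z ^ (k + Suc n)) + (\<Sum>k<Suc n. fps_nth f k * z ^ k)"
    unfolding eval_fps_def by (rule suminf_split_initial_segment[OF s])
  also have "(\<Sum>k. fps_nth f (k + Suc n) * z ^ (k + Suc n)) = (\<Sum>k. z ^ Suc n * (fps_nth (fps_shift (Suc n) f) k * z ^ k))"
    by (simp add: power_add mult_ac)
  also have "\<dots> = z ^ Suc n * eval_fps (fps_shift (Suc n) f) z"
    unfolding eval_fps_def
    by (rule suminf_mult[OF summable_fps]) (use assms in simp)
  finally show ?thesis by (simp add: lessThan_Suc_atMost)
qed

text \<open>For the monomial \<open>w ^ n\<close> only the term of the series with index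
  \<open>n\<close> contributes a residue. Splitting the series after this term leaves a polynomial
  divided by \<open>w\<close>, for Cauchy's formula, and a tail with a primitive, so no series is
  integrated termwise.\<close>

lemma moment_contour_integral:
  fixes f :: "complex fps"
  assumes f: "fps_conv_radius f \<ge> 1" and R: "R > 1"
  shows "((\<lambda>w. poly p w * (eval_fps f (1 / w) / w)) has_contour_integral
            2 * of_real pi * \<i> * moment (fps_nth f) p) (circlepath 0 R)"
proof -
  have mono: "((\<lambda>w. w ^ n * (eval_fps f (1 / w) / w)) has_contour_integral
            2 * of_real pi * \<i> * fps_nth f n) (circlepath 0 R)" for n
  proof -
    define S where "S = eval_fps (fps_shift (Suc n) f)"
    have "S holomorphic_on ball 0 1"
      unfolding S_def using f by (intro holomorphic_on_eval_fps_unit_ball) simp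
    from holomorphic_convex_primitive'[OF convex_ball open_ball this] obtain \<Phi> where
      \<Phi>: "\<And>z. z \<in> ball 0 1 \<Longrightarrow> (\<Phi> has_field_derivative S z) (at z within ball 0 1)" by metis
    define Q where "Q = (\<lambda>w. \<Sum>k\<le>n. fps_nth f k * w ^ (n - k))"
    have Q_int: "((\<lambda>w. Q w / (w - 0)) has_contour_integral 2 * of_real pi * \<i> * Q 0) (circlepath 0 R)"
      using R by (intro Cauchy_integral_circlepath_simple) (auto simp: Q_def intro!: holomorphic_intros)
    have Q0: "Q 0 = fps_nth f n"
    proof -
      have "Q 0 = (\<Sum>k\<le>n. if k = n then fps_nth f n else 0)"
        unfolding Q_def by (intro sum.cong) auto
      then show ?thesis by simp
    qed
    \<comment> \<open>The tail is the derivative of \<open>- \<Phi> (1 / w)\<close>, where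
      \<open>\<Phi>\<close> is a primitive of \<open>S\<close> on the unit disc.\<close>
    have "((\<lambda>w. S (1 / w) / w ^ 2) has_contour_integral 0) (circlepath 0 R)"
    proof (rule Cauchy_theorem_primitive)
      fix w :: complex assume w: "w \<in> - cball 0 1"
      then have "1 < norm w" by simp
      from one_less_normD[OF this] have w0: "w \<noteq> 0" and "1 / w \<in> ball 0 1" by auto
      then have "(\<Phi> has_field_derivative S (1 / w)) (at (1 / w))"
        using \<Phi>[of "1 / w"] by (metis at_within_open open_ball)
      moreover have "((\<lambda>w. 1 / w) has_field_derivative - 1 / w ^ 2) (at w)"
        using w0 by (auto intro!: derivative_eq_intros simp: power2_eq_square)
      ultimately have "((\<lambda>w. \<Phi> (1 / w)) has_field_derivative S (1 / w) * (- 1 / w ^ 2)) (at w)"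
        by (rule DERIV_chain2)
      from DERIV_minus[OF this]
      show "((\<lambda>w. - \<Phi> (1 / w)) has_field_derivative S (1 / w) / w ^ 2) (at w within - cball 0 1)"
        by (simp add: has_field_derivative_at_within)
    qed (use R in auto)
    from has_contour_integral_add[OF Q_int this]
    have "((\<lambda>w. Q w / w + S (1 / w) / w ^ 2) has_contour_integral 2 * of_real pi * \<i> * fps_nth f n) (circlepath 0 R)"
      by (simp add: Q0)
    then show ?thesis
    proof (rule has_contour_integral_eq)
      fix w assume "w \<in> path_image (circlepath 0 R)"
      then have w: "norm w = R" using R by simp
      then have w0: "w \<noteq> 0" using R by auto
      have "norm (1 / w) < 1" using w R by (intro one_less_normD) simp
      then have "ereal (norm (1 / w)) < 1"
        by simp
      also have "\<dots> \<le> fps_conv_radius f"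
        by (rule f)
      finally have "ereal (norm (1 / w)) < fps_conv_radius f" .
      from eval_fps_split_shift[OF this, of n]
      have "w ^ n * (eval_fps f (1 / w) / w)
              = (\<Sum>k\<le>n. fps_nth f k * (w ^ n * (1 / w) ^ k)) / w + (w ^ n * (1 / w) ^ Suc n) * S (1 / w) / w"
        by (simp add: S_def ring_distribs sum_distrib_left mult_ac add_divide_distrib)
      also have "(\<Sum>k\<le>n. fps_nth f k * (w ^ n * (1 / w) ^ k)) = Q w"
        unfolding Q_def using w0 by (intro sum.cong) (auto simp: power_diff field_simps)
      also have "w ^ n * (1 / w) ^ Suc n = 1 / w"
        using w0 by (simp add: field_simps)
      finally show "Q w / w + S (1 / w) / w ^ 2 = w ^ n * (eval_fps f (1 / w) / w)"
        by (simp add: power2_eq_square)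
    qed
  qed
  have "((\<lambda>w. \<Sum>i\<le>degree p. coeff p i * (w ^ i * (eval_fps f (1 / w) / w))) has_contour_integral
      (\<Sum>i\<le>degree p. coeff p i * (2 * of_real pi * \<i> * fps_nth f i))) (circlepath 0 R)"
    by (intro has_contour_integral_sum has_contour_integral_lmul mono) auto
  then show ?thesis
    by (simp add: moment_def poly_altdef sum_distrib_left sum_distrib_right mult_ac)
qed

lemma has_contour_integral_part_circlepath_combine:
  assumes "a < b" "b < c"
    and "(f has_contour_integral i) (part_circlepath z r a b)"
    and "(f has_contour_integral j) (part_circlepath z r b c)"
  shows "(f has_contour_integral (i + j)) (part_circlepath z r a c)"
  using assms
  by (auto simp: has_contour_integral_part_circlepath_iff intro!: has_integral_combine[of a b c])

text \<open>The hypotheses bound \<open>norm (1 - w) ^ 2\<close> by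
  \<open>3 / 4 * \<epsilon> ^ 2\<close>. This places the cap that the line
  \<open>Re w = 1 - \<epsilon> ^ 2 / 8\<close> cuts off inside the ball where the continuation is
  available.\<close>

lemma in_ball_one_if_Re_ge:
  fixes w :: complex
  assumes "norm w \<le> R" "R ^ 2 \<le> 1 + \<epsilon> ^ 2 / 2" "Re w \<ge> 1 - \<epsilon> ^ 2 / 8" "\<epsilon> > 0"
  shows "w \<in> ball 1 \<epsilon>"
proof -
  have "norm (1 - w) ^ 2 = norm w ^ 2 + 1 - 2 * Re w"
    unfolding cmod_power2 by (simp add: power2_eq_square algebra_simps)
  moreover have "norm w ^ 2 \<le> R ^ 2" by (rule power_mono[OF assms(1) norm_ge_zero])
  moreover have "\<epsilon> ^ 2 > 0" using assms(4) by simp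
  ultimately have "norm (1 - w) ^ 2 < \<epsilon> ^ 2" using assms(2,3) by linarith
  then have "norm (1 - w) < \<epsilon>" by (rule power_less_imp_less_base) (use assms(4) in simp)
  then show ?thesis by (simp add: dist_norm)
qed

text \<open>Cauchy's theorem in the variable \<open>w = 1 / z\<close>: the arc of the circle of radius \<open>R\<close> near
  \<open>1\<close> is replaced by its chord, inside a ball on which the continuation lives.\<close>

lemma norm_moment_le_of_continuation:
  fixes f :: "complex fps"
  assumes f: "fps_conv_radius f \<ge> 1"
    and h: "h holomorphic_on ball 1 \<rho>" "\<And>z. z \<in> ball 1 \<rho> \<inter> ball 0 1 \<Longrightarrow> h z = eval_fps f z"
    and \<epsilon>: "0 < \<epsilon>" "\<epsilon> \<le> 1/2" "\<epsilon> \<le> \<rho> / 2"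
    and R: "1 < R" "R ^ 2 \<le> 1 + \<epsilon> ^ 2 / 2"
  shows "\<exists>C. \<forall>p m. (\<forall>w. norm w \<le> R \<longrightarrow> Re w \<le> 1 - \<epsilon> ^ 2 / 8 \<longrightarrow> norm (poly p w) \<le> m) \<longrightarrow>
           norm (moment (fps_nth f) p) \<le> C * m"
proof -
  define c where "c = 1 - \<epsilon> ^ 2 / 8"
  have "\<epsilon> ^ 2 \<le> 1" using \<epsilon> by (simp add: abs_square_le_1)
  then have c: "0 < c" "c < 1" using \<epsilon> by (auto simp: c_def)
  \<comment> \<open>Half the angle of the arc that the chord \<open>Re w = c\<close> cuts
    off.\<close>
  define \<theta> where "\<theta> = arccos (c / R)"
  have cR: "0 < c / R" "c / R < 1" using c R by (auto simp: field_simps)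
  have cos\<theta>: "cos \<theta> = c / R" using cR by (simp add: \<theta>_def)
  have \<theta>: "0 < \<theta>" "\<theta> < pi"
    using cR arccos_lt_bounded[of "c / R"] by (auto simp: \<theta>_def)
  \<comment> \<open>\<open>g2\<close> continues the weight \<open>g\<close> across the unit circle
    near 1; the two are identified on the circle of radius \<open>R\<close>, where
    \<open>1 / w\<close> lies in the unit disc.\<close>
  define g where "g = (\<lambda>w. eval_fps f (1 / w) / w)"
  define g2 where "g2 = (\<lambda>w. h (1 / w) / w)"
  have ball0: "w \<noteq> 0" if "w \<in> ball 1 \<epsilon>" for w :: complex
    using that \<epsilon> by auto
  \<comment> \<open>Since \<open>\<epsilon> \<le> 1/2\<close> keeps \<open>norm w\<close> above 1/2,
    inversion at most doubles the distance to 1, and \<open>\<epsilon> \<le> \<rho> / 2\<close>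
    absorbs this factor.\<close>
  have inv_ball: "1 / w \<in> ball 1 \<rho>" if "w \<in> ball 1 \<epsilon>" for w :: complex
  proof -
    have lt: "norm (1 - w) < \<epsilon>" using that by (simp add: dist_norm)
    have "1 - norm w \<le> norm (1 - w)" using norm_triangle_ineq2[of 1 w] by simp
    then have nw: "norm w > 1/2" using lt \<epsilon> by linarith
    have "1 - 1 / w = (w - 1) / w" using ball0[OF that] by (simp add: field_simps)
    then have "norm (1 - 1 / w) = norm (1 - w) / norm w" by (simp add: norm_divide norm_minus_commute)
    also have "\<dots> < \<epsilon> / norm w" using nw lt by (intro divide_strict_right_mono) auto
    also have "\<dots> \<le> \<epsilon> / (1/2)" using nw \<epsilon> by (intro divide_left_mono) auto
    also have "\<dots> \<le> \<rho>" using \<epsilon> by simp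
    finally show ?thesis by (simp add: dist_norm)
  qed
  have g2_hol: "g2 holomorphic_on ball 1 \<epsilon>"
    unfolding g2_def using ball0 inv_ball
    by (intro holomorphic_intros holomorphic_on_compose_gen[OF _ h(1), unfolded o_def]) auto
  have g_eq: "g w = g2 w" if "w \<in> ball 1 \<epsilon>" "norm w = R" for w
  proof -
    have "1 / w \<in> ball 0 1" using one_less_normD[of w] that(2) R by simp
    then show ?thesis using h(2) inv_ball[OF that(1)] by (simp add: g_def g2_def)
  qed
  define z1 z2 where "z1 = R * exp (\<i> * of_real \<theta>)" and "z2 = R * exp (\<i> * of_real (2 * pi - \<theta>))"
  have Rez: "Re z1 = c" "Re z2 = c"
    using cos\<theta> R by (simp_all add: z1_def z2_def Re_exp Im_exp)
  have normz: "norm z1 = R" "norm z2 = R"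
    using R by (simp_all add: z1_def z2_def norm_mult)
  have segm: "norm w \<le> R" "Re w = c" if "w \<in> closed_segment z2 z1" for w
  proof -
    have "closed_segment z2 z1 \<subseteq> cball 0 R"
      using normz by (intro closed_segment_subset) auto
    then show "norm w \<le> R" using that by auto
    obtain u where "w = (1 - u) *\<^sub>R z2 + u *\<^sub>R z1"
      using \<open>w \<in> closed_segment z2 z1\<close> by (auto simp: closed_segment_def)
    then have "Re w = (1 - u) * c + u * c" using Rez by simp
    then show "Re w = c" by (simp add: algebra_simps)
  qed
  have seg_ball: "closed_segment z2 z1 \<subseteq> ball 1 \<epsilon>"
    using segm R \<epsilon> by (auto intro!: in_ball_one_if_Re_ge[of _ R] simp: c_def simp del: mem_ball)
  \<comment> \<open>The circle is parametrised from angle 0, the middle of the arc to be replaced,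
    so this arc consists of the two pieces \<open>?A\<close> and \<open>?D\<close>.\<close>
  let ?A = "part_circlepath 0 R 0 \<theta>" and ?B = "part_circlepath 0 R \<theta> (2 * pi - \<theta>)"
    and ?D = "part_circlepath 0 R (2 * pi - \<theta>) (2 * pi)"
  have img: "\<exists>t. w = R * cis t \<and> a \<le> t \<and> t \<le> b"
    if "w \<in> path_image (part_circlepath 0 R a b)" "a \<le> b" for w a b
  proof -
    have "w \<in> (\<lambda>t. R * cis t) ` {a..b}"
      using that by (simp add: path_image_part_circlepath' closed_segment_eq_real_ivl)
    then show ?thesis by (elim imageE) (metis atLeastAtMost_iff)
  qed
  have imgB: "norm w \<le> R" "Re w \<le> c" if "w \<in> path_image ?B" for w
  proof -
    from that obtain t where t: "w = R * cis t" "\<theta> \<le> t" "t \<le> 2 * pi - \<theta>"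
      using img[of w \<theta> "2 * pi - \<theta>"] \<theta> by auto
    have "cos t \<le> cos \<theta>"
    proof (cases "t \<le> pi")
      case True
      then show ?thesis using t \<theta> by (intro cos_monotone_0_pi_le) auto
    next
      case False
      then have "cos (2 * pi - t) \<le> cos \<theta>" using t \<theta> by (intro cos_monotone_0_pi_le) auto
      then show ?thesis by simp
    qed
    then have "R * cos t \<le> c" using cos\<theta> R by (simp add: field_simps)
    then show "norm w \<le> R" "Re w \<le> c" using t R by (simp_all add: norm_mult)
  qed
  have cap: "w \<in> ball 1 \<epsilon> \<and> norm w = R" if "w = R * cis t" "cos \<theta> \<le> cos t" for w t
  proof -
    have "c \<le> R * cos t" using that(2) cos\<theta> R by (simp add: field_simps)
    then show ?thesis
      using that(1) R \<epsilon> by (auto intro!: in_ball_one_if_Re_ge[of _ R] simp: c_def norm_mult simp del: mem_ball)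
  qed
  have imgA: "w \<in> ball 1 \<epsilon> \<and> norm w = R" if "w \<in> path_image ?A" for w
  proof -
    from that obtain t where "w = R * cis t" "0 \<le> t" "t \<le> \<theta>"
      using img[of w 0 \<theta>] \<theta> by auto
    then show ?thesis using \<theta> by (intro cap[of _ t] cos_monotone_0_pi_le) auto
  qed
  have imgD: "w \<in> ball 1 \<epsilon> \<and> norm w = R" if "w \<in> path_image ?D" for w
  proof -
    from that obtain t where t: "w = R * cis t" "2 * pi - \<theta> \<le> t" "t \<le> 2 * pi"
      using img[of w "2 * pi - \<theta>" "2 * pi"] \<theta> by auto
    have "cos \<theta> \<le> cos (2 * pi - t)" using t \<theta> by (intro cos_monotone_0_pi_le) auto
    then show ?thesis using t by (intro cap[of _ t]) auto
  qed
  have g_hol: "g holomorphic_on - cball 0 1"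
  proof -
    have "eval_fps f holomorphic_on ball 0 1"
      using f by (rule holomorphic_on_eval_fps_unit_ball)
    then have "(eval_fps f \<circ> (\<lambda>w. 1 / w)) holomorphic_on - cball 0 1"
    proof (rule holomorphic_on_compose_gen[rotated])
      show "(\<lambda>w. 1 / w) holomorphic_on - cball (0::complex) 1"
        by (intro holomorphic_intros) auto
      show "(\<lambda>w. 1 / w) ` (- cball (0::complex) 1) \<subseteq> ball 0 1"
        using one_less_normD by fastforce
    qed
    then show ?thesis
      unfolding g_def o_def by (intro holomorphic_on_divide holomorphic_on_ident) auto
  qed
  have "bounded (g ` sphere 0 R)"
    using R by (intro compact_imp_bounded compact_continuous_image holomorphic_on_imp_continuous_on
        holomorphic_on_subset[OF g_hol]) auto
  then obtain b1 where b1: "b1 > 0" "\<And>w. norm w = R \<Longrightarrow> norm (g w) \<le> b1"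
    unfolding bounded_pos by fastforce
  have "bounded (g2 ` closed_segment z2 z1)"
    by (intro compact_imp_bounded compact_continuous_image holomorphic_on_imp_continuous_on
        holomorphic_on_subset[OF g2_hol] seg_ball) auto
  then obtain b2 where b2: "b2 > 0" "\<And>w. w \<in> closed_segment z2 z1 \<Longrightarrow> norm (g2 w) \<le> b2"
    unfolding bounded_pos by fastforce
  \<comment> \<open>Length of the chord times the bound on \<open>g2\<close>, plus length of the
    remaining arc times the bound on \<open>g\<close>; the division by \<open>2 * pi\<close> is
    forgone.\<close>
  define C where "C = b2 * norm (z1 - z2) + b1 * R * (2 * pi - \<theta> - \<theta>)"
  have main: "norm (moment (fps_nth f) p) \<le> C * m"
    if m: "\<And>w. norm w \<le> R \<Longrightarrow> Re w \<le> c \<Longrightarrow> norm (poly p w) \<le> m" for p m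
  proof -
    have m0: "m \<ge> 0" using m[of 0] c R by (simp add: order_trans[OF norm_ge_zero])
    have "(\<lambda>w. poly p w * g2 w) holomorphic_on ball 1 \<epsilon>"
      by (intro holomorphic_intros g2_hol)
    \<comment> \<open>Through this primitive the integrals over \<open>?A\<close> and
      \<open>?D\<close> add up to \<open>\<Psi> z1 - \<Psi> z2\<close>, which is also the integral
      along the chord from \<open>z2\<close> to \<open>z1\<close>.\<close>
    from holomorphic_convex_primitive'[OF convex_ball open_ball this] obtain \<Psi> where
      \<Psi>: "\<And>w. w \<in> ball 1 \<epsilon> \<Longrightarrow> (\<Psi> has_field_derivative poly p w * g2 w) (at w within ball 1 \<epsilon>)"
      by metis
    have "((\<lambda>w. poly p w * g2 w) has_contour_integral \<Psi> (pathfinish ?A) - \<Psi> (pathstart ?A)) ?A"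
      using imgA by (intro contour_integral_primitive[OF \<Psi>]) auto
    then have IA: "((\<lambda>w. poly p w * g w) has_contour_integral \<Psi> z1 - \<Psi> R) ?A"
      using imgA g_eq by (simp add: z1_def) (erule has_contour_integral_eq, auto)
    have "((\<lambda>w. poly p w * g2 w) has_contour_integral \<Psi> (pathfinish ?D) - \<Psi> (pathstart ?D)) ?D"
      using imgD by (intro contour_integral_primitive[OF \<Psi>]) auto
    moreover have "pathfinish ?D = R" "pathstart ?D = z2"
      by (simp_all add: z2_def mult.commute[of \<i>])
    ultimately have "((\<lambda>w. poly p w * g2 w) has_contour_integral \<Psi> R - \<Psi> z2) ?D"
      by (simp only:)
    then have ID: "((\<lambda>w. poly p w * g w) has_contour_integral \<Psi> R - \<Psi> z2) ?D"
      by (rule has_contour_integral_eq) (use imgD g_eq in auto)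
    have "continuous_on (sphere 0 R) (\<lambda>w. poly p w * g w)"
      using R by (intro continuous_intros holomorphic_on_imp_continuous_on holomorphic_on_subset[OF g_hol]) auto
    then have "continuous_on (path_image ?B) (\<lambda>w. poly p w * g w)"
      by (rule continuous_on_subset) (use R in \<open>intro path_image_part_circlepath_subset', simp\<close>)
    then obtain I where I: "((\<lambda>w. poly p w * g w) has_contour_integral I) ?B"
      using contour_integrable_continuous_part_circlepath unfolding contour_integrable_on_def by blast
    have "((\<lambda>w. poly p w * g w) has_contour_integral ((\<Psi> z1 - \<Psi> R) + I) + (\<Psi> R - \<Psi> z2)) (part_circlepath 0 R 0 (2 * pi))"
      using \<theta> by (intro has_contour_integral_part_circlepath_combine[of _ "2 * pi - \<theta>"]
          has_contour_integral_part_circlepath_combine[of _ \<theta>] IA I ID) auto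
    moreover have "((\<lambda>w. poly p w * g w) has_contour_integral 2 * of_real pi * \<i> * moment (fps_nth f) p) (part_circlepath 0 R 0 (2 * pi))"
      using moment_contour_integral[OF f R(1), of p] by (simp add: g_def circlepath_def)
    ultimately have "2 * of_real pi * \<i> * moment (fps_nth f) p = ((\<Psi> z1 - \<Psi> R) + I) + (\<Psi> R - \<Psi> z2)"
      using has_contour_integral_unique by blast
    then have eq: "2 * of_real pi * \<i> * moment (fps_nth f) p = (\<Psi> z1 - \<Psi> z2) + I" by simp
    have "norm (\<Psi> z1 - \<Psi> z2) \<le> (m * b2) * norm (z1 - z2)"
    proof (rule has_contour_integral_bound_linepath)
      show "((\<lambda>w. poly p w * g2 w) has_contour_integral \<Psi> z1 - \<Psi> z2) (linepath z2 z1)"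
        using contour_integral_primitive[OF \<Psi>, where g = "linepath z2 z1"] seg_ball by simp
      show "norm (poly p w * g2 w) \<le> m * b2" if "w \<in> closed_segment z2 z1" for w
        unfolding norm_mult using segm[OF that] m[of w] b2(2)[OF that] m0 by (intro mult_mono) auto
    qed (use m0 b2 in auto)
    moreover have "norm I \<le> (m * b1) * R * ((2 * pi - \<theta>) - \<theta>)"
    proof (rule has_contour_integral_bound_part_circlepath[OF I])
      show "norm (poly p w * g w) \<le> m * b1" if "w \<in> path_image ?B" for w
      proof -
        have "norm w = R" using in_path_image_part_circlepath[OF that] \<theta> R by simp
        then show ?thesis
          unfolding norm_mult using imgB[OF that] m[of w] b1(2)[of w] m0 by (intro mult_mono) auto
      qed
    qed (use m0 b1 R \<theta> in auto)
    ultimately have "norm (2 * of_real pi * \<i> * moment (fps_nth f) p) \<le> C * m"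
      using norm_triangle_ineq[of "\<Psi> z1 - \<Psi> z2" I] unfolding eq by (simp add: C_def algebra_simps)
    moreover have "1 * norm (moment (fps_nth f) p) \<le> (2 * pi) * norm (moment (fps_nth f) p)"
      using pi_ge_two by (intro mult_right_mono) auto
    moreover have "norm (2 * of_real pi * \<i> * moment (fps_nth f) p) = (2 * pi) * norm (moment (fps_nth f) p)"
      by (simp add: norm_mult)
    ultimately show ?thesis by linarith
  qed
  then show ?thesis unfolding c_def by blast
qed

section \<open>Rotation of the point of continuation to 1\<close>

lemma eval_fps_rotate:
  fixes u :: "'a :: {banach, real_normed_field}"
  shows "eval_fps (Abs_fps (\<lambda>n. fps_nth f n * u ^ n)) z = eval_fps f (u * z)"
  by (simp add: eval_fps_def power_mult_distrib mult_ac)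

lemma fps_conv_radius_rotate:
  fixes u :: "'a :: {banach, real_normed_field}"
  assumes "norm u = 1"
  shows "fps_conv_radius (Abs_fps (\<lambda>n. fps_nth f n * u ^ n)) = fps_conv_radius f"
  unfolding fps_conv_radius_def
  by (subst (1 2) conv_radius_norm[symmetric]) (simp add: norm_mult norm_power assms)

lemma moment_pcompose_linear:
  fixes u :: "'a :: idom"
  shows "moment a (pcompose p [:0, u:]) = moment (\<lambda>n. a n * u ^ n) p"
proof -
  have "degree (pcompose p [:0, u:]) \<le> degree p"
    using degree_pcompose_le[of p "[:0, u:]"] by (simp split: if_splits)
  from moment_eq[OF this] show ?thesis
    by (simp add: moment_def coeff_pcompose_linear mult_ac)
qed

text \<open>With \<open>m = degree q\<close>, the product of \<open>q ^ (i div m)\<close> and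
  \<open>monom 1 (i mod m)\<close> has degree \<open>i\<close> and is about \<open>s ^ i\<close> in
  size, where \<open>s\<close> is the \<open>m\<close>-th root of the bound for \<open>q\<close>.
  Rotating back multiplies leading coefficients by powers of \<open>u\<close>, so they are of norm 1
  only and not equal to 1.\<close>

lemma small_moments_of_continuation:
  fixes f :: "complex fps"
  assumes f: "fps_conv_radius f \<ge> 1" and u: "norm u = 1" and \<rho>: "\<rho> > 0"
    and h: "h holomorphic_on ball u \<rho>" "\<And>z. z \<in> ball u \<rho> \<inter> ball 0 1 \<Longrightarrow> h z = eval_fps f z"
  obtains p :: "nat \<Rightarrow> complex poly" and C s :: real
  where "0 < s" "s < 1" "\<And>i. degree (p i) = i" "\<And>i. norm (lead_coeff (p i)) = 1"
    "\<And>i j. norm (moment (fps_nth f) (p i * p j)) \<le> C * s ^ (i + j)"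
proof -
  define f' where "f' = Abs_fps (\<lambda>n. fps_nth f n * u ^ n)"
  have f'_nth: "fps_nth f' = (\<lambda>n. fps_nth f n * u ^ n)" by (simp add: f'_def fun_eq_iff)
  have f': "fps_conv_radius f' \<ge> 1"
    using f fps_conv_radius_rotate[OF u] by (simp add: f'_def)
  have u_ball: "u * z \<in> ball u \<rho>" if "z \<in> ball 1 \<rho>" for z
  proof -
    have "u - u * z = u * (1 - z)" by (simp add: algebra_simps)
    then show ?thesis using that u by (simp add: dist_norm norm_mult)
  qed
  have "(h \<circ> (\<lambda>z. u * z)) holomorphic_on ball 1 \<rho>"
    by (rule holomorphic_on_compose_gen[OF _ h(1)]) (use u_ball in \<open>auto intro!: holomorphic_intros\<close>)
  then have h': "(\<lambda>z. h (u * z)) holomorphic_on ball 1 \<rho>" by (simp add: o_def)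
  have h'_eq: "h (u * z) = eval_fps f' z" if "z \<in> ball 1 \<rho> \<inter> ball 0 1" for z
    unfolding f'_def eval_fps_rotate by (rule h(2)) (use that u_ball[of z] u in \<open>auto simp: norm_mult\<close>)
  define \<epsilon> where "\<epsilon> = min (1/2) (\<rho>/2)"
  have \<epsilon>: "0 < \<epsilon>" "\<epsilon> \<le> 1/2" "\<epsilon> \<le> \<rho>/2" using \<rho> by (auto simp: \<epsilon>_def)
  have \<epsilon>2: "0 < \<epsilon> ^ 2" "\<epsilon> ^ 2 \<le> 1" using \<epsilon> by (auto simp: abs_square_le_1)
  obtain q :: "complex poly" and R0 r where q: "lead_coeff q = 1" "degree q > 0" "1 < R0" "0 < r" "r < 1"
    "\<And>w. norm w \<le> R0 \<Longrightarrow> Re w \<le> 1 - \<epsilon> ^ 2 / 8 \<Longrightarrow> norm (poly q w) \<le> r"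
    using truncated_disc_monic_poly[of "1 - \<epsilon> ^ 2 / 8"] \<epsilon>2 by auto
  \<comment> \<open>The second bound ensures \<open>R ^ 2 \<le> 1 + \<epsilon> ^ 2 / 2\<close>, as
    the cap estimate demands.\<close>
  define R where "R = min R0 (1 + \<epsilon> ^ 2 / 8)"
  have R: "1 < R" "R \<le> R0" "R \<le> 1 + \<epsilon> ^ 2 / 8" using q \<epsilon>2 by (auto simp: R_def)
  have "R ^ 2 \<le> (1 + \<epsilon> ^ 2 / 8) ^ 2" using R by (intro power_mono) auto
  also have "\<dots> = 1 + \<epsilon> ^ 2 / 4 + \<epsilon> ^ 2 * \<epsilon> ^ 2 / 64" by (simp add: power2_eq_square algebra_simps)
  also have "\<epsilon> ^ 2 * \<epsilon> ^ 2 \<le> \<epsilon> ^ 2 * 1" using \<epsilon>2 by (intro mult_left_mono) auto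
  finally have R2: "R ^ 2 \<le> 1 + \<epsilon> ^ 2 / 2" using \<epsilon>2 by linarith
  obtain C0 where C0: "\<And>p m. (\<And>w. norm w \<le> R \<Longrightarrow> Re w \<le> 1 - \<epsilon> ^ 2 / 8 \<Longrightarrow> norm (poly p w) \<le> m) \<Longrightarrow>
           norm (moment (fps_nth f') p) \<le> C0 * m"
    using norm_moment_le_of_continuation[OF f' h' h'_eq \<epsilon> R(1) R2] by blast
  define m where "m = degree q"
  define s where "s = root m r"
  have m: "m > 0" using q by (simp add: m_def)
  have s: "0 < s" "s < 1" "s ^ m = r" using q m by (simp_all add: s_def)
  define p' where "p' = (\<lambda>i. q ^ (i div m) * monom 1 (i mod m))"
  \<comment> \<open>\<open>2 ^ m\<close> bounds the monomial factor, as
    \<open>norm w \<le> 2\<close>, and \<open>1 / r\<close> pays for the rounding in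
    \<open>i div m\<close>.\<close>
  define D where "D = 2 ^ m / r"
  have q0: "q \<noteq> 0" using q by auto
  have deg': "degree (p' i) = i" for i
  proof -
    have "degree (p' i) = i div m * m + i mod m"
      using q0 by (simp add: p'_def degree_mult_eq degree_power_eq degree_monom_eq m_def)
    then show ?thesis by simp
  qed
  have lead': "lead_coeff (p' i) = 1" for i
    using q(1) by (simp add: p'_def lead_coeff_mult lead_coeff_power degree_monom_eq)
  have bound': "norm (poly (p' i) w) \<le> D * s ^ i" if w: "norm w \<le> R" "Re w \<le> 1 - \<epsilon> ^ 2 / 8" for i w
  proof -
    have "norm (poly (p' i) w) = norm (poly q w) ^ (i div m) * norm w ^ (i mod m)"
      by (simp add: p'_def poly_monom norm_mult norm_power)
    also have "\<dots> \<le> r ^ (i div m) * 2 ^ m"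
    proof (intro mult_mono power_mono)
      show "norm (poly q w) \<le> r" using q(6)[of w] w R by simp
      have "norm w ^ (i mod m) \<le> 2 ^ (i mod m)" using w R \<epsilon>2 by (intro power_mono) auto
      also have "\<dots> \<le> 2 ^ m" using m by (intro power_increasing) (auto intro: less_imp_le)
      finally show "norm w ^ (i mod m) \<le> 2 ^ m" .
    qed (use q in auto)
    also have "\<dots> \<le> D * s ^ i"
    proof -
      have "r ^ (i div m) * r = s ^ (m * (i div m)) * s ^ m" by (simp add: power_mult s)
      also have "\<dots> \<le> s ^ (m * (i div m)) * s ^ (i mod m)"
        using s m by (intro mult_left_mono power_decreasing) (auto intro: less_imp_le)
      also have "\<dots> = s ^ i" by (simp flip: power_add)
      finally have "r ^ (i div m) * r \<le> s ^ i" .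
      then have "2 ^ m * (r ^ (i div m) * r) \<le> 2 ^ m * s ^ i" by (intro mult_left_mono) auto
      then show ?thesis using q by (simp add: D_def field_simps)
    qed
    finally show ?thesis .
  qed
  show ?thesis
  proof (rule that[of s "\<lambda>i. pcompose (p' i) [:0, u:]" "C0 * (D * D)"])
    have u0: "u \<noteq> 0" using u by auto
    show deg: "degree (pcompose (p' i) [:0, u:]) = i" for i
      using u0 by (simp add: degree_pcompose deg')
    show "norm (lead_coeff (pcompose (p' i) [:0, u:])) = 1" for i
      using lead'[of i] by (simp only: deg coeff_pcompose_linear) (simp add: deg' norm_mult norm_power u)
    show "norm (moment (fps_nth f) (pcompose (p' i) [:0, u:] * pcompose (p' j) [:0, u:]))
            \<le> C0 * (D * D) * s ^ (i + j)" for i j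
    proof -
      have "norm (moment (fps_nth f') (p' i * p' j)) \<le> C0 * ((D * s ^ i) * (D * s ^ j))"
      proof (rule C0)
        fix w assume "norm w \<le> R" "Re w \<le> 1 - \<epsilon> ^ 2 / 8"
        from bound'[OF this, of i] bound'[OF this, of j]
        show "norm (poly (p' i * p' j) w) \<le> (D * s ^ i) * (D * s ^ j)"
          unfolding poly_mult norm_mult by (intro mult_mono) (auto intro: order_trans[OF norm_ge_zero])
      qed
      then show ?thesis
        by (simp add: moment_pcompose_linear f'_nth power_add mult_ac flip: pcompose_mult)
    qed
  qed (use s in auto)
qed

theorem polya_carlson:
  fixes f :: "complex fps"
  assumes int: "\<And>n. fps_nth f n \<in> \<int>" and f: "fps_conv_radius f \<ge> 1"
    and u: "norm u = 1" and \<rho>: "\<rho> > 0"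
    and h: "h holomorphic_on ball u \<rho>" "\<And>z. z \<in> ball u \<rho> \<inter> ball 0 1 \<Longrightarrow> h z = eval_fps f z"
  shows "\<exists>B P. B \<noteq> 0 \<and> f * fps_of_poly B = fps_of_poly P"
proof -
  define a where "a = fps_nth f"
  obtain p :: "nat \<Rightarrow> complex poly" and C s where p: "0 < s" "s < 1" "\<And>i. degree (p i) = i"
    "\<And>i. norm (lead_coeff (p i)) = 1" "\<And>i j. norm (moment a (p i * p j)) \<le> C * s ^ (i + j)"
    unfolding a_def using small_moments_of_continuation[OF f u \<rho> h] by metis
  have "eventually (hankel_singular a) sequentially"
    using eventually_hankel_singular[OF _ p(3-5,1,2)] int by (simp add: a_def)
  then obtain N where N: "\<And>n. n \<ge> N \<Longrightarrow> hankel_singular a n"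
    unfolding eventually_sequentially by blast
  \<comment> \<open>The largest nonsingular size. It exists because size 0 is nonsingular: no
    polynomial has degree below 0.\<close>
  define d where "d = (LEAST d. \<forall>n>d. hankel_singular a n)"
  have d: "\<forall>n>d. hankel_singular a n"
    unfolding d_def by (rule LeastI[of _ N]) (use N in auto)
  have nonsing: "\<not> hankel_singular a d"
  proof
    assume sing: "hankel_singular a d"
    then have "d > 0" by (auto simp: hankel_singular_def)
    have "\<forall>n>d - 1. hankel_singular a n"
    proof (intro allI impI)
      fix n assume "n > d - 1"
      then show "hankel_singular a n" using d sing by (cases "n = d") auto
    qed
    then have "d \<le> d - 1" unfolding d_def by (rule Least_le)
    then show False using \<open>d > 0\<close> by simp
  qed
  \<comment> \<open>A kernel vector for size \<open>d + 1\<close> of degree below \<open>d\<close>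
    would also be one for size \<open>d\<close>. So its degree is exactly \<open>d\<close>, and
    normalisation yields the orthogonal polynomial.\<close>
  obtain c where c: "c \<noteq> 0" "degree c \<le> d" "\<And>j. j \<le> d \<Longrightarrow> moment a (c * monom 1 j) = 0"
    using d[rule_format, of "Suc d"] by (auto simp: hankel_singular_def less_Suc_eq_le)
  have degc: "degree c = d"
  proof (rule ccontr)
    assume "degree c \<noteq> d"
    then have "hankel_singular a d" unfolding hankel_singular_def using c by (intro exI[of _ c]) auto
    then show False using nonsing by simp
  qed
  define b where "b = Polynomial.smult (inverse (lead_coeff c)) c"
  have "coeff c d \<noteq> 0" using leading_coeff_neq_0[OF c(1)] unfolding degc .
  then have b: "degree b = d" "lead_coeff b = 1" using degc by (simp_all add: b_def)
  have b_moment: "moment a (b * monom 1 j) = 0" if "j < d" for j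
    using c(3)[of j] that by (simp add: b_def moment_smult)
  have "moment a (b * monom 1 j) = 0" for j
    by (rule kronecker_hankel[OF _ b b_moment nonsing]) (use d in auto)
  moreover have "b \<noteq> 0" using b by auto
  ultimately show ?thesis
    using fps_rational_of_recurrence[of b a] by (simp add: a_def fps_nth_inverse)
qed

section \<open>Logarithmic derivatives of rational functions\<close>

lemma fps_inverse_linear:
  fixes \<rho> :: "'a :: field"
  assumes "\<rho> \<noteq> 0"
  shows "inverse (fps_of_poly [:-\<rho>, 1:]) = Abs_fps (\<lambda>n. - ((1 / \<rho>) ^ Suc n))"
proof (rule fps_inverse_unique)
  have "fps_of_poly [:-\<rho>, 1:] * Abs_fps (\<lambda>n. - ((1 / \<rho>) ^ Suc n))
      = fps_const (- \<rho>) * Abs_fps (\<lambda>n. - ((1 / \<rho>) ^ Suc n)) + fps_X * Abs_fps (\<lambda>n. - ((1 / \<rho>) ^ Suc n))"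
    by (simp add: fps_of_poly_pCons algebra_simps)
  also have "\<dots> = 1"
  proof (rule fps_ext)
    fix n show "fps_nth (fps_const (- \<rho>) * Abs_fps (\<lambda>n. - ((1 / \<rho>) ^ Suc n))
        + fps_X * Abs_fps (\<lambda>n. - ((1 / \<rho>) ^ Suc n))) n = fps_nth 1 n"
      using assms by (cases n) (simp_all add: field_simps)
  qed
  finally show "fps_of_poly [:-\<rho>, 1:] * Abs_fps (\<lambda>n. - ((1 / \<rho>) ^ Suc n)) = 1" .
qed

text \<open>The logarithmic derivative is a sum of \<open>1 / (X - \<rho>)\<close> over the roots \<open>\<rho>\<close>.\<close>

lemma log_deriv_poly_bounded:
  fixes p :: "complex poly"
  assumes "\<And>z. norm z < 1 \<Longrightarrow> poly p z \<noteq> 0"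
  shows "\<exists>C. \<forall>n. norm (fps_nth (fps_of_poly (pderiv p) * inverse (fps_of_poly p)) n) \<le> C"
  using assms
proof (induction "degree p" arbitrary: p rule: less_induct)
  case less
  show ?case
  proof (cases "degree p = 0")
    case True
    then have "pderiv p = 0" by (simp add: pderiv_eq_0_iff)
    then show ?thesis by auto
  next
    case False
    then have "\<not> (\<exists>a l. a \<noteq> 0 \<and> l = 0 \<and> p = pCons a l)" by auto
    then obtain \<rho> where \<rho>: "poly p \<rho> = 0"
      using fundamental_theorem_of_algebra_alt by blast
    then obtain q where q: "p = [:-\<rho>, 1:] * q" by (auto simp: poly_eq_0_iff_dvd elim: dvdE)
    have n\<rho>: "norm \<rho> \<ge> 1" using less.prems[of \<rho>] \<rho> by force
    then have \<rho>0: "\<rho> \<noteq> 0" by auto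
    have "q \<noteq> 0" using False q by auto
    then have "degree q < degree p" unfolding q by (subst degree_mult_eq) auto
    moreover have q_nz: "poly q z \<noteq> 0" if "norm z < 1" for z
      using less.prems[OF that] by (simp add: q)
    ultimately obtain C where C: "\<And>n. norm (fps_nth (fps_of_poly (pderiv q) * inverse (fps_of_poly q)) n) \<le> C"
      using less.hyps by blast
    let ?L = "fps_of_poly [:-\<rho>, 1:]" and ?Q = "fps_of_poly q"
    have "fps_nth ?Q 0 \<noteq> 0" using q_nz[of 0] by (simp add: poly_0_coeff_0)
    then have Q: "?Q * inverse ?Q = 1" by (rule inverse_mult_eq_1')
    have L: "?L * inverse ?L = 1" by (rule inverse_mult_eq_1') (use \<rho>0 in simp)
    have "fps_of_poly (pderiv p) = ?L * fps_of_poly (pderiv q) + ?Q"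
      unfolding q pderiv_mult by (simp add: fps_of_poly_add fps_of_poly_mult pderiv_pCons)
    moreover have "inverse (fps_of_poly p) = inverse ?L * inverse ?Q"
      unfolding q by (simp only: fps_of_poly_mult fps_inverse_mult)
    ultimately have "fps_of_poly (pderiv p) * inverse (fps_of_poly p)
        = (?L * inverse ?L) * (fps_of_poly (pderiv q) * inverse ?Q) + (?Q * inverse ?Q) * inverse ?L"
      by (simp only: algebra_simps)
    then have eq: "fps_of_poly (pderiv p) * inverse (fps_of_poly p)
        = fps_of_poly (pderiv q) * inverse ?Q + inverse ?L"
      by (simp only: Q L mult_1)
    \<comment> \<open>Every root has modulus at least 1, so its geometric series adds at most 1 to
      the bound.\<close>
    have "norm (fps_nth (fps_of_poly (pderiv p) * inverse (fps_of_poly p)) n) \<le> C + 1" for n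
    proof -
      have "norm (fps_nth (inverse ?L) n) = (1 / norm \<rho>) ^ Suc n"
        by (simp add: fps_inverse_linear[OF \<rho>0] norm_mult norm_power norm_divide)
      also have "\<dots> \<le> 1"
        using n\<rho> \<rho>0 by (intro power_le_one) (simp_all add: divide_le_eq_1_pos)
      finally show ?thesis
        unfolding eq fps_add_nth by (intro norm_triangle_le add_mono C)
    qed
    then show ?thesis by blast
  qed
qed

text \<open>The formal composition represents \<open>exp \<circ> eval_fps E\<close> near 0 at first.
  As this function is holomorphic on the whole unit disc, its Taylor series converges to it
  there.\<close>

lemma exp_compose_eval_fps:
  fixes E :: "complex fps"
  assumes E0: "fps_nth E 0 = 0" and E: "fps_conv_radius E \<ge> 1"
  shows "fps_conv_radius (fps_exp 1 oo E) \<ge> 1"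
    and "norm z < 1 \<Longrightarrow> eval_fps (fps_exp 1 oo E) z = exp (eval_fps E z)"
proof -
  have "eval_fps E has_fps_expansion E"
    using E by (auto simp: has_fps_expansion_def intro: less_le_trans[of 0 1])
  then have exp: "(exp \<circ> eval_fps E) has_fps_expansion (fps_exp 1 oo E)"
    by (intro has_fps_expansion_compose has_fps_expansion_exp1 E0)
  have "z \<in> eball 0 (fps_conv_radius E)" if "norm z < 1" for z
    using that less_le_trans[OF _ E, of "ereal (norm z)"] by (simp add: in_eball_iff)
  then have hol: "(exp \<circ> eval_fps E) holomorphic_on ball 0 1"
    unfolding o_def by (intro holomorphic_intros) auto
  show "fps_conv_radius (fps_exp 1 oo E) \<ge> 1"
    using holomorphic_on_imp_fps_conv_radius_ge[OF exp, of 1] hol by (simp add: one_ereal_def)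
  show "eval_fps (fps_exp 1 oo E) z = exp (eval_fps E z)" if "norm z < 1"
    using has_fps_expansion_imp_eval_fps_eq[OF exp that hol] by simp
qed

lemma bounded_log_coeffs_if_rational:
  fixes E :: "complex fps"
  assumes E0: "fps_nth E 0 = 0" and E: "fps_conv_radius E \<ge> 1"
    and rat: "B \<noteq> 0" "(fps_exp 1 oo E) * fps_of_poly B = fps_of_poly P"
  shows "\<exists>C. \<forall>n. norm (of_nat n * fps_nth E n) \<le> C"
proof -
  define f where "f = fps_exp 1 oo E"
  define Q where "Q = (\<lambda>B. B \<noteq> 0 \<and> (\<exists>P. f * fps_of_poly B = fps_of_poly P))"
  have "Q B" using rat by (auto simp: Q_def f_def)
  \<comment> \<open>A denominator of least degree: by the identity below, a zero in the disc would
    be shared with the numerator, and the common factor could be cancelled.\<close>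
  from ex_has_least_nat[of Q, OF this, of degree] obtain B where
    B: "Q B" and least: "\<And>B'. Q B' \<Longrightarrow> degree B \<le> degree B'" by blast
  from B obtain P where B0: "B \<noteq> 0" and P: "f * fps_of_poly B = fps_of_poly P" by (auto simp: Q_def)
  note f = exp_compose_eval_fps[OF E0 E, folded f_def]
  have eval: "poly P z = exp (eval_fps E z) * poly B z" if "norm z < 1" for z
  proof -
    have "ereal (norm z) < fps_conv_radius f"
      using that less_le_trans[OF _ f(1), of "ereal (norm z)"] by simp
    from eval_fps_mult[OF this, of "fps_of_poly B"] show ?thesis
      using that by (simp add: P f(2))
  qed
  have B_nz: "poly B z \<noteq> 0" if "norm z < 1" for z
  proof
    assume Bz: "poly B z = 0"
    then have "poly P z = 0" using eval[OF that] by simp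
    then obtain P1 where P1: "P = [:-z, 1:] * P1" by (auto simp: poly_eq_0_iff_dvd elim: dvdE)
    from Bz obtain B1 where B1: "B = [:-z, 1:] * B1" by (auto simp: poly_eq_0_iff_dvd elim: dvdE)
    have "fps_of_poly [:-z, 1:] * (f * fps_of_poly B1) = fps_of_poly [:-z, 1:] * fps_of_poly P1"
      using P unfolding P1 B1 fps_of_poly_mult by (simp only: mult_ac)
    \<comment> \<open>As \<open>z\<close> may be 0, the linear factor need not be invertible as a
      series; it is cancelled as a nonzero element of a domain.\<close>
    moreover have "fps_nth (fps_of_poly [:-z, 1:]) 1 \<noteq> 0" by simp
    then have "fps_of_poly [:-z, 1:] \<noteq> 0" by (metis fps_zero_nth)
    ultimately have "f * fps_of_poly B1 = fps_of_poly P1" by (metis mult_left_cancel)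
    moreover have "B1 \<noteq> 0" using B0 B1 by auto
    ultimately have "degree B \<le> degree B1" by (intro least) (auto simp: Q_def)
    then show False unfolding B1 using \<open>B1 \<noteq> 0\<close> by (subst (asm) degree_mult_eq) auto
  qed
  have P_nz: "poly P z \<noteq> 0" if "norm z < 1" for z
    using eval[OF that] B_nz[OF that] by simp
  let ?B = "fps_of_poly B" and ?P = "fps_of_poly P"
  have iB: "?B * inverse ?B = 1" and iP: "?P * inverse ?P = 1"
    using B_nz[of 0] P_nz[of 0] by (auto intro!: inverse_mult_eq_1' simp: poly_0_coeff_0)
  \<comment> \<open>Differentiating \<open>f * ?B = ?P\<close> and dividing by \<open>?P\<close>
    gives the derivative of \<open>E\<close> as the difference of two logarithmic
    derivatives.\<close>
  have "fps_deriv f = f * fps_deriv E"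
    unfolding f_def using E0 by (simp add: fps_compose_deriv)
  then have "fps_of_poly (pderiv P) = f * fps_of_poly (pderiv B) + f * fps_deriv E * ?B"
    using arg_cong[OF P, of fps_deriv] by (simp add: fps_of_poly_pderiv)
  then have "fps_of_poly (pderiv P) * inverse ?P
      = (f * ?B * inverse ?P) * (fps_of_poly (pderiv B) * inverse ?B) + (f * ?B * inverse ?P) * fps_deriv E"
    using iB by (simp add: algebra_simps)
  then have eq: "fps_deriv E = fps_of_poly (pderiv P) * inverse ?P - fps_of_poly (pderiv B) * inverse ?B"
    unfolding P iP by simp
  obtain C1 C2 where
    C1: "\<And>n. norm (fps_nth (fps_of_poly (pderiv P) * inverse ?P) n) \<le> C1" and
    C2: "\<And>n. norm (fps_nth (fps_of_poly (pderiv B) * inverse ?B) n) \<le> C2"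
    using log_deriv_poly_bounded P_nz B_nz by metis
  have bound: "norm (fps_nth (fps_deriv E) n) \<le> C1 + C2" for n
    unfolding eq fps_sub_nth using C1 C2 by (meson add_mono norm_triangle_ineq4 order_trans)
  have "norm (of_nat n * fps_nth E n) \<le> C1 + C2" for n
  proof (cases n)
    case 0
    then show ?thesis using order_trans[OF norm_ge_zero bound[of 0]] by simp
  next
    case (Suc m)
    then show ?thesis using bound[of m] by simp
  qed
  then show ?thesis by blast
qed

section \<open>Counting subgroups of finite index\<close>

lemma bij_betw_images_same_kernel:
  assumes "\<And>x y. x \<in> A \<Longrightarrow> y \<in> A \<Longrightarrow> f x = f y \<longleftrightarrow> g x = g y"
  shows "\<exists>h. bij_betw h (f ` A) (g ` A)"
proof
  have inv: "inv_into A f (f x) \<in> A" "f (inv_into A f (f x)) = f x" if "x \<in> A" for x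
    using that by (auto intro: inv_into_into f_inv_into_f)
  then have "g (inv_into A f (f x)) = g x" if "x \<in> A" for x
    using assms that by blast
  then show "bij_betw (\<lambda>v. g (inv_into A f v)) (f ` A) (g ` A)"
    using assms by (auto simp: bij_betw_def inj_on_def image_image cong: image_cong)
qed

context group
begin

lemma r_coset_eq_iff:
  assumes "subgroup L G" "x \<in> carrier G" "y \<in> carrier G"
  shows "L #> x = L #> y \<longleftrightarrow> x \<otimes> inv y \<in> L"
proof -
  have "L #> x = L #> y \<longleftrightarrow> x \<in> L #> y"
    using assms by (metis rcos_self repr_independence)
  also have "\<dots> \<longleftrightarrow> x \<otimes> inv y \<in> L"
    using subgroup.rcos_module[OF assms(1) is_group assms(3,2)] .
  finally show ?thesis .
qed

lemma bij_betw_rcosets_image: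
  assumes "subgroup L G"
    and "\<And>x y. x \<in> carrier G \<Longrightarrow> y \<in> carrier G \<Longrightarrow> c x = c y \<longleftrightarrow> x \<otimes> inv y \<in> L"
  shows "\<exists>h. bij_betw h (rcosets L) (c ` carrier G)"
proof -
  have "rcosets L = (\<lambda>x. L #> x) ` carrier G" by (auto simp: RCOSETS_def)
  then show ?thesis
    using bij_betw_images_same_kernel[of "carrier G" "\<lambda>x. L #> x" c] assms
    by (simp add: r_coset_eq_iff)
qed

text \<open>This is multiplicativity of the index along \<open>L \<subseteq> H\<close>, with the
  right cosets of \<open>L\<close> in \<open>H\<close> labelled by the values of \<open>c\<close>,
  so that an index is found by computing an image.\<close>

lemma bij_betw_rcosets_times_image:
  assumes H: "subgroup H G" and L: "subgroup L G" "L \<subseteq> H"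
    and c: "\<And>x y. x \<in> H \<Longrightarrow> y \<in> H \<Longrightarrow> c x = c y \<longleftrightarrow> x \<otimes> inv y \<in> L"
  shows "\<exists>h. bij_betw h (rcosets L) ((rcosets H) \<times> c ` H)"
proof -
  define rep where "rep = (\<lambda>C. SOME x. x \<in> carrier G \<and> C = H #> x)"
  have rep: "rep (H #> x) \<in> carrier G \<and> H #> x = H #> rep (H #> x)" if "x \<in> carrier G" for x
    unfolding rep_def by (rule someI[of _ x]) (use that in simp)
  \<comment> \<open>An element is recorded by its coset of \<open>H\<close> and by the label of its
    position relative to the chosen representative.\<close>
  define d where "d = (\<lambda>x. (H #> x, c (x \<otimes> inv (rep (H #> x)))))"
  have memH: "x \<otimes> inv (rep (H #> x)) \<in> H" if "x \<in> carrier G" for x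
    using rep[OF that] r_coset_eq_iff[OF H that] by blast
  have HG: "x \<in> carrier G" if "x \<in> H" for x using subgroup.mem_carrier[OF H that] .
  have "\<exists>h. bij_betw h (rcosets L) (d ` carrier G)"
  proof (rule bij_betw_rcosets_image[OF L(1)])
    fix x y assume xy: "x \<in> carrier G" "y \<in> carrier G"
    show "d x = d y \<longleftrightarrow> x \<otimes> inv y \<in> L"
    proof (cases "H #> x = H #> y")
      case True
      define r where "r = rep (H #> y)"
      have r: "r \<in> carrier G" using rep[OF xy(2)] by (simp add: r_def)
      have "d x = d y \<longleftrightarrow> (x \<otimes> inv r) \<otimes> inv (y \<otimes> inv r) \<in> L"
        using c memH[OF xy(1)] memH[OF xy(2)] True by (simp add: d_def r_def)
      also have "(x \<otimes> inv r) \<otimes> inv (y \<otimes> inv r) = x \<otimes> inv y"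
        using xy r by (simp add: inv_mult_group m_assoc) (simp flip: m_assoc)
      finally show ?thesis .
    next
      case False
      then show ?thesis using L(2) r_coset_eq_iff[OF H xy] by (auto simp: d_def)
    qed
  qed
  moreover have "d ` carrier G = (rcosets H) \<times> c ` H"
  proof (intro equalityI subsetI)
    fix z assume "z \<in> d ` carrier G"
    then show "z \<in> (rcosets H) \<times> c ` H" using memH by (auto simp: d_def RCOSETS_def)
  next
    fix z assume "z \<in> (rcosets H) \<times> c ` H"
    then obtain g x where z: "z = (H #> g, c x)" "g \<in> carrier G" "x \<in> H" by (auto simp: RCOSETS_def)
    define r where "r = rep (H #> g)"
    have r: "r \<in> carrier G" "H #> g = H #> r" using rep[OF z(2)] by (simp_all add: r_def)
    have rr: "rep (H #> r) = r" by (subst r(2)[symmetric]) (simp add: r_def)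
    have "H #> (x \<otimes> r) = H #> r"
      using r_coset_eq_iff[OF H, of "x \<otimes> r" r] z HG r by (simp add: m_assoc)
    then have "d (x \<otimes> r) = z"
      using z HG r rr by (simp add: d_def m_assoc)
    then show "z \<in> d ` carrier G" using HG z r by blast
  qed
  ultimately show ?thesis by simp
qed

section \<open>Finite generation and finiteness of the number of subgroups of given index\<close>

definition fin_gen :: "'a set \<Rightarrow> bool" where
  "fin_gen H \<longleftrightarrow> (\<exists>Y. finite Y \<and> Y \<subseteq> carrier G \<and> H = generate G Y)"

lemma fin_gen_if_finite_index:
  assumes H: "subgroup H G" "finite (rcosets H)" "fin_gen H"
  shows "fin_gen (carrier G)"
proof -
  obtain Y where Y: "finite Y" "Y \<subseteq> carrier G" "H = generate G Y" using H(3) by (auto simp: fin_gen_def)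
  have "rcosets H \<subseteq> (\<lambda>x. H #> x) ` carrier G" by (auto simp: RCOSETS_def)
  from finite_subset_image[OF H(2) this] obtain T
    where T: "T \<subseteq> carrier G" "finite T" "rcosets H = (\<lambda>x. H #> x) ` T" by auto
  have "x \<in> generate G (Y \<union> T)" if x: "x \<in> carrier G" for x
  proof -
    have "H #> x \<in> rcosets H" using x by (auto simp: RCOSETS_def)
    then obtain \<tau> where \<tau>: "\<tau> \<in> T" "H #> x = H #> \<tau>" using T(3) by auto
    then have \<tau>G: "\<tau> \<in> carrier G" using T by auto
    have "x \<otimes> inv \<tau> \<in> H" using r_coset_eq_iff[OF H(1) x \<tau>G] \<tau> by simp
    moreover have "generate G Y \<subseteq> generate G (Y \<union> T)" by (rule mono_generate) blast
    ultimately have "x \<otimes> inv \<tau> \<in> generate G (Y \<union> T)" unfolding Y(3) by (rule rev_subsetD)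
    moreover have "\<tau> \<in> generate G (Y \<union> T)" using \<tau>(1) by (intro generate.incl) simp
    ultimately have "(x \<otimes> inv \<tau>) \<otimes> \<tau> \<in> generate G (Y \<union> T)"
      by (rule generate.eng)
    then show ?thesis using x \<tau>G by (simp add: m_assoc)
  qed
  moreover have YT: "Y \<union> T \<subseteq> carrier G" using Y T by simp
  ultimately have "carrier G = generate G (Y \<union> T)" using generate_incl[OF YT] by (intro equalityI subsetI) auto
  moreover have "finite (Y \<union> T)" using Y T by simp
  ultimately show ?thesis unfolding fin_gen_def using YT by blast
qed

text \<open>A subgroup of index \<open>n\<close> is determined by the permutation action of the generators on its
  cosets, numbered such that the subgroup itself gets the number \<open>0\<close>.\<close>

lemma finite_subgroups_of_index:
  assumes fg: "fin_gen (carrier G)"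
  shows "finite {L. subgroup L G \<and> finite (rcosets L) \<and> card (rcosets L) = n}" (is "finite ?S")
proof -
  obtain Y where Y: "finite Y" "Y \<subseteq> carrier G" "carrier G = generate G Y" using fg by (auto simp: fin_gen_def)
  have self: "L \<in> rcosets L" if "subgroup L G" for L
    using that by (metis coset_join2 one_closed rcosetsI subgroup.one_closed subgroup.subset)
  have "\<exists>\<phi>. bij_betw \<phi> (rcosets L) {..<n} \<and> \<phi> L = 0" if L: "L \<in> ?S" for L
  proof -
    have "finite (rcosets L)" "card (rcosets L) = n" using L by auto
    then obtain \<psi> where \<psi>: "bij_betw \<psi> (rcosets L) {..<n}"
      using ex_bij_betw_finite_nat[of "rcosets L"] by (auto simp: atLeast0LessThan)
    then have "\<psi> L < n" using self L by (auto simp: bij_betw_def)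
    then have "bij_betw (Transposition.transpose (\<psi> L) 0) {..<n} {..<n}"
      by (intro permutes_imp_bij permutes_swap_id) auto
    from bij_betw_trans[OF \<psi> this] have "bij_betw (Transposition.transpose (\<psi> L) 0 \<circ> \<psi>) (rcosets L) {..<n}" .
    then show ?thesis by (intro exI[of _ "Transposition.transpose (\<psi> L) 0 \<circ> \<psi>"]) simp
  qed
  then have "\<forall>L\<in>?S. \<exists>\<phi>. bij_betw \<phi> (rcosets L) {..<n} \<and> \<phi> L = 0" by (intro ballI)
  from bchoice[OF this] obtain \<phi>
    where \<phi>': "\<forall>L\<in>?S. bij_betw (\<phi> L) (rcosets L) {..<n} \<and> \<phi> L L = 0" ..
  have \<phi>: "bij_betw (\<phi> L) (rcosets L) {..<n}" "\<phi> L L = 0" if "L \<in> ?S" for L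
    using bspec[OF \<phi>' that] by simp_all
  \<comment> \<open>The table of the permutations given by the generators, restricted to its finite
    domain so that only finitely many tables exist.\<close>
  define act where "act = (\<lambda>L. \<lambda>(y, k) \<in> Y \<times> {..<n}. \<phi> L (inv_into (rcosets L) (\<phi> L) k #> y))"
  have coset: "C #> g \<in> rcosets L" if "C \<in> rcosets L" "g \<in> carrier G" "subgroup L G" for C g L
    using that by (auto simp: RCOSETS_def coset_mult_assoc[OF subgroup.subset])
  have "act ` ?S \<subseteq> (Y \<times> {..<n}) \<rightarrow>\<^sub>E {..<n}"
  proof (intro subsetI)
    fix a assume "a \<in> act ` ?S"
    then obtain L where L: "L \<in> ?S" "a = act L" by auto
    have "\<phi> L (inv_into (rcosets L) (\<phi> L) k #> y) < n" if "y \<in> Y" "k < n" for y k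
    proof -
      have "inv_into (rcosets L) (\<phi> L) k \<in> rcosets L"
        using \<phi>(1)[OF L(1)] that by (auto simp: bij_betw_def intro!: inv_into_into)
      then have "inv_into (rcosets L) (\<phi> L) k #> y \<in> rcosets L"
        using coset that Y L by auto
      then show ?thesis using \<phi>(1)[OF L(1)] by (auto simp: bij_betw_def)
    qed
    then show "a \<in> (Y \<times> {..<n}) \<rightarrow>\<^sub>E {..<n}" unfolding L(2) act_def by auto
  qed
  moreover have "finite ((Y \<times> {..<n}) \<rightarrow>\<^sub>E {..<n})" using Y by (intro finite_PiE) auto
  ultimately have "finite (act ` ?S)" by (rule finite_subset)
  moreover have "inj_on act ?S"
  proof (rule inj_onI)
    fix L M assume L: "L \<in> ?S" and M: "M \<in> ?S" and eq: "act L = act M"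
    \<comment> \<open>Cosets with equal numbers are matched. Equality of the tables makes this
      matching commute with translation by the generators, hence by all of the group.\<close>
    define \<psi> where "\<psi> = (\<lambda>C. inv_into (rcosets M) (\<phi> M) (\<phi> L C))"
    have bij: "bij_betw \<psi> (rcosets L) (rcosets M)"
      unfolding \<psi>_def using bij_betw_trans[OF \<phi>(1)[OF L] bij_betw_inv_into[OF \<phi>(1)[OF M]]]
      by (simp add: o_def)
    have \<psi>L: "\<psi> L = M"
      using \<phi>(2)[OF L] \<phi>(2)[OF M] self M \<phi>(1)[OF M]
      by (simp add: \<psi>_def) (metis (mono_tags, lifting) bij_betw_inv_into_left mem_Collect_eq)
    have sub: "L \<subseteq> carrier G" "M \<subseteq> carrier G" using L M subgroup.subset by auto
    have coset_sub: "C \<subseteq> carrier G" if "C \<in> rcosets L" for C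
      using that L subgroup.rcosets_carrier[OF _ is_group] by blast
    have coset_sub': "C \<subseteq> carrier G" if "C \<in> rcosets M" for C
      using that M subgroup.rcosets_carrier[OF _ is_group] by blast
    have \<psi>_in: "\<psi> C \<in> rcosets M" if "C \<in> rcosets L" for C
      using bij that by (auto simp: bij_betw_def)
    have equiv: "\<forall>C \<in> rcosets L. \<psi> (C #> g) = \<psi> C #> g" if "g \<in> generate G Y" for g
      using that
    proof (induction rule: generate.induct)
      case one
      show ?case using coset_sub coset_sub' \<psi>_in by (auto simp: coset_mult_one)
    next
      case (incl y)
      show ?case
      proof
        fix C assume C: "C \<in> rcosets L"
        define k where "k = \<phi> L C"
        have k: "k < n" using \<phi>(1)[OF L] C by (auto simp: k_def bij_betw_def)
        have "inv_into (rcosets L) (\<phi> L) k = C"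
          using \<phi>(1)[OF L] C by (simp add: k_def bij_betw_inv_into_left)
        then have "\<phi> L (C #> y) = \<phi> M (\<psi> C #> y)"
          using fun_cong[OF eq, of "(y, k)"] k incl by (simp add: act_def \<psi>_def k_def)
        moreover have "\<psi> C #> y \<in> rcosets M" using coset \<psi>_in C M incl Y by auto
        ultimately show "\<psi> (C #> y) = \<psi> C #> y"
          using \<phi>(1)[OF M] by (simp add: \<psi>_def bij_betw_inv_into_left)
      qed
    next
      case (inv y)
      show ?case
      proof
        fix C assume C: "C \<in> rcosets L"
        have y: "y \<in> carrier G" using inv Y by auto
        \<comment> \<open>The table has no entries for inverses, so the entry for \<open>y\<close>
          is read at the coset \<open>C #> inv y\<close>.\<close>
        define k where "k = \<phi> L (C #> inv y)"
        have Cy: "C #> inv y \<in> rcosets L" using coset C y L by auto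
        have k: "k < n" using \<phi>(1)[OF L] Cy by (auto simp: k_def bij_betw_def)
        have "inv_into (rcosets L) (\<phi> L) k = C #> inv y"
          using \<phi>(1)[OF L] Cy by (simp add: k_def bij_betw_inv_into_left)
        then have "\<phi> L ((C #> inv y) #> y) = \<phi> M (\<psi> (C #> inv y) #> y)"
          using fun_cong[OF eq, of "(y, k)"] k inv by (simp add: act_def \<psi>_def k_def)
        moreover have "(C #> inv y) #> y = C"
          using y coset_sub[OF C] by (simp add: coset_mult_assoc coset_mult_one)
        moreover have "\<psi> (C #> inv y) #> y \<in> rcosets M" using coset \<psi>_in Cy M y by auto
        ultimately have "\<psi> C = \<psi> (C #> inv y) #> y"
          using \<phi>(1)[OF M] by (simp add: \<psi>_def bij_betw_inv_into_left)
        then show "\<psi> (C #> inv y) = \<psi> C #> inv y"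
          using y coset_sub'[OF \<psi>_in[OF Cy]] by (simp add: coset_mult_assoc coset_mult_one)
      qed
    next
      case (eng g1 g2)
      show ?case
      proof
        fix C assume C: "C \<in> rcosets L"
        have g: "g1 \<in> carrier G" "g2 \<in> carrier G" using eng Y by auto
        have "\<psi> (C #> (g1 \<otimes> g2)) = \<psi> ((C #> g1) #> g2)"
          using g coset_sub[OF C] by (simp add: coset_mult_assoc)
        also have "\<dots> = (\<psi> C #> g1) #> g2" using eng C coset g L by auto
        also have "\<dots> = \<psi> C #> (g1 \<otimes> g2)"
          using g coset_sub'[OF \<psi>_in[OF C]] by (simp add: coset_mult_assoc)
        finally show "\<psi> (C #> (g1 \<otimes> g2)) = \<psi> C #> (g1 \<otimes> g2)" .
      qed
    qed
    \<comment> \<open>Each subgroup is the stabiliser of itself among its cosets, and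
      \<open>\<psi>\<close> matches these two cosets as both have number 0.\<close>
    have "g \<in> L \<longleftrightarrow> g \<in> M" if g: "g \<in> carrier G" for g
    proof -
      have sL: "subgroup L G" and sM: "subgroup M G" using L M by auto
      have "g \<in> L \<longleftrightarrow> L #> g = L" using coset_join1[OF _ g sL] coset_join2[OF g sL] by auto
      also have "\<dots> \<longleftrightarrow> \<psi> (L #> g) = \<psi> L"
        using bij_betw_imp_inj_on[OF bij] self[OF sL] coset[OF self[OF sL] g sL] by (simp add: inj_on_eq_iff)
      also have "\<dots> \<longleftrightarrow> M #> g = M" 
        using bspec[OF equiv self[OF sL], of g] g \<psi>L by (simp flip: Y(3))
      also have "\<dots> \<longleftrightarrow> g \<in> M" using coset_join1[OF _ g sM] coset_join2[OF g sM] by auto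
      finally show ?thesis .
    qed
    then show "L = M" using sub by blast
  qed
  ultimately show ?thesis by (rule finite_imageD)
qed

end

section \<open>Extensions by infinite cyclic groups\<close>

lemma (in group) infinite_cyclic_int_pow_inj:
  assumes "q \<in> carrier G" "carrier G = range (\<lambda>n::int. q [^] n)" "infinite (carrier G)"
    and "q [^] (i::int) = q [^] (j::int)"
  shows "i = j"
proof (rule ccontr)
  assume "i \<noteq> j"
  define d where "d = \<bar>i - j\<bar>"
  have d: "d > 0" using \<open>i \<noteq> j\<close> by (simp add: d_def)
  have "q [^] (i - j) = \<one>" "q [^] (j - i) = \<one>"
    using assms(1,4) by (simp_all add: int_pow_diff)
  then have qd: "q [^] d = \<one>" by (simp add: d_def abs_if)
  have "q [^] n \<in> (\<lambda>k. q [^] k) ` {0..<d}" for n :: int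
  proof -
    have "q [^] n = q [^] (d * (n div d) + n mod d)" by simp
    also have "\<dots> = (q [^] d) [^] (n div d) \<otimes> q [^] (n mod d)"
      using assms(1) by (simp only: int_pow_mult int_pow_pow)
    also have "\<dots> = q [^] (n mod d)" using qd assms(1) by simp
    finally show ?thesis using d by auto
  qed
  then have "carrier G \<subseteq> (\<lambda>k. q [^] k) ` {0..<d}" using assms(2) by auto
  then show False using assms(3) finite_subset by blast
qed

text \<open>\<open>H\<close> is the semidirect product of the kernel of \<open>e\<close> and the
  infinite cyclic group generated by \<open>t\<close>. This form replaces a cyclic factor of a
  series by data on elements, without quotient groups.\<close>

locale int_extension = group G for G (structure) +
  fixes H :: "'a set" and e :: "'a \<Rightarrow> int" and t :: 'a
  assumes H: "subgroup H G"
    and e_mult: "\<And>x y. x \<in> H \<Longrightarrow> y \<in> H \<Longrightarrow> e (x \<otimes> y) = e x + e y"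
    and t_in: "t \<in> H" and e_t: "e t = 1"
begin

lemma HG [simp]: "x \<in> H \<Longrightarrow> x \<in> carrier G"
  using subgroup.mem_carrier[OF H] .

lemma H_mult [simp]: "x \<in> H \<Longrightarrow> y \<in> H \<Longrightarrow> x \<otimes> y \<in> H"
  using subgroup.m_closed[OF H] .

lemma H_inv [simp]: "x \<in> H \<Longrightarrow> inv x \<in> H"
  using subgroup.m_inv_closed[OF H] .

lemma H_one [simp]: "\<one> \<in> H"
  using subgroup.one_closed[OF H] .

lemma e_one [simp]: "e \<one> = 0"
  using e_mult[of \<one> \<one>] by simp

lemma e_inv [simp]: "x \<in> H \<Longrightarrow> e (inv x) = - e x"
  using e_mult[of x "inv x"] by simp

lemma t_carrier [simp]: "t \<in> carrier G"
  using t_in by simp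

lemma t_pow_nat: "t [^] (n::nat) \<in> H \<and> e (t [^] n) = int n"
  by (induction n) (auto simp: e_mult t_in e_t)

lemma t_pow [simp]: "t [^] (k::int) \<in> H" "e (t [^] k) = k"
proof -
  have "t [^] k \<in> H \<and> e (t [^] k) = k"
  proof (cases k rule: int_cases2)
    case (nonneg n)
    then show ?thesis using t_pow_nat[of n] by (simp add: int_pow_int)
  next
    case (nonpos n)
    then show ?thesis using t_pow_nat[of n] by (simp add: int_pow_neg_int)
  qed
  then show "t [^] k \<in> H" "e (t [^] k) = k" by simp_all
qed

definition Ker :: "'a set" where
  "Ker = {x \<in> H. e x = 0}"

lemma Ker_I: "x \<in> H \<Longrightarrow> e x = 0 \<Longrightarrow> x \<in> Ker"
  by (simp add: Ker_def)

lemma Ker_H [simp]: "x \<in> Ker \<Longrightarrow> x \<in> H"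
  by (simp add: Ker_def)

lemma e_Ker [simp]: "x \<in> Ker \<Longrightarrow> e x = 0"
  by (simp add: Ker_def del: Ker_H)

lemma Ker_mult [simp]: "x \<in> Ker \<Longrightarrow> y \<in> Ker \<Longrightarrow> x \<otimes> y \<in> Ker"
  by (rule Ker_I) (simp_all add: e_mult)

lemma Ker_inv [simp]: "x \<in> Ker \<Longrightarrow> inv x \<in> Ker"
  by (rule Ker_I) simp_all

lemma Ker_one [simp]: "\<one> \<in> Ker"
  by (rule Ker_I) simp_all

lemma t_component_in_Ker: "x \<in> H \<Longrightarrow> x \<otimes> inv (t [^] e x) \<in> Ker"
  by (rule Ker_I) (simp_all add: e_mult)

lemma fin_gen_extension:
  assumes "fin_gen Ker"
  shows "fin_gen H"
proof -
  obtain Y where Y: "finite Y" "Y \<subseteq> carrier G" "Ker = generate G Y" using assms by (auto simp: fin_gen_def)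
  have "Y \<subseteq> H" using Y(3) generate.incl[of _ Y G] by auto
  then have YH: "insert t Y \<subseteq> H" using t_in by simp
  have t_gen: "t [^] (k::int) \<in> generate G (insert t Y)" for k
  proof -
    have "subgroup (generate G (insert t Y)) G"
      using YH by (intro generate_is_subgroup) auto
    then show ?thesis by (rule subgroup_int_pow_closed) (auto intro: generate.incl)
  qed
  have "x \<in> generate G (insert t Y)" if x: "x \<in> H" for x
  proof -
    have "x \<otimes> inv (t [^] e x) \<in> Ker" using x by (rule t_component_in_Ker)
    moreover have "generate G Y \<subseteq> generate G (insert t Y)" by (rule mono_generate) blast
    ultimately have "x \<otimes> inv (t [^] e x) \<in> generate G (insert t Y)" unfolding Y(3) by (rule rev_subsetD)
    from generate.eng[OF this t_gen[of "e x"]] show ?thesis using x by (simp add: m_assoc)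
  qed
  moreover have "generate G (insert t Y) \<subseteq> H"
    using generate_subgroup_incl[OF YH H] .
  ultimately have "H = generate G (insert t Y)" by blast
  moreover have "finite (insert t Y)" using Y by simp
  ultimately show ?thesis unfolding fin_gen_def using YH by (metis HG subset_iff)
qed

definition t_conj :: "int \<Rightarrow> 'a \<Rightarrow> 'a" where
  "t_conj k x = t [^] k \<otimes> x \<otimes> inv (t [^] k)"

lemma t_conj_Ker [simp]: "x \<in> Ker \<Longrightarrow> t_conj k x \<in> Ker"
  unfolding t_conj_def by (rule Ker_I) (simp_all add: e_mult)

lemma t_conj_mult: "x \<in> H \<Longrightarrow> y \<in> H \<Longrightarrow> t_conj k (x \<otimes> y) = t_conj k x \<otimes> t_conj k y"
proof -
  assume xy: "x \<in> H" "y \<in> H"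
  have "inv (t [^] k) \<otimes> (t [^] k \<otimes> (y \<otimes> inv (t [^] k))) = y \<otimes> inv (t [^] k)"
    using xy by (simp flip: m_assoc)
  then show ?thesis using xy by (simp add: t_conj_def m_assoc)
qed

lemma t_conj_add: "x \<in> H \<Longrightarrow> t_conj (k + l) x = t_conj k (t_conj l x)"
  by (simp add: t_conj_def int_pow_mult inv_mult_group m_assoc)

lemma t_conj_zero [simp]: "x \<in> H \<Longrightarrow> t_conj 0 x = x"
  by (simp add: t_conj_def)

end

text \<open>Two consecutive infinite cyclic factors. Unlike the kernel of \<open>e\<close>, that of
  \<open>f\<close> is not assumed to be normal in \<open>H\<close>: conjugation by \<open>t\<close>
  may change \<open>f\<close>.\<close>

locale int_extension2 = int_extension +
  fixes f :: "'a \<Rightarrow> int" and s :: 'a and n :: nat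
  assumes f_mult: "\<And>x y. x \<in> Ker \<Longrightarrow> y \<in> Ker \<Longrightarrow> f (x \<otimes> y) = f x + f y"
    and s_in: "s \<in> Ker" and f_s: "f s = 1"
    and fgA: "fin_gen Ker" and n: "n > 0"
begin

lemma f_one [simp]: "f \<one> = 0"
  using f_mult[of \<one> \<one>] by simp

lemma f_inv [simp]: "x \<in> Ker \<Longrightarrow> f (inv x) = - f x"
  using f_mult[of x "inv x"] by simp

lemma s_pow: "s [^] (k::nat) \<in> Ker \<and> f (s [^] k) = int k"
  by (induction k) (auto simp: f_mult s_in f_s)

text \<open>Conjugation by \<open>t\<close> acts on the finite set of homomorphisms from the finitely generated
  group \<open>Ker\<close> to the integers modulo \<open>n\<close>, so some power of \<open>t\<close> fixes \<open>f\<close> modulo \<open>n\<close>.\<close>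

lemma ex_fixing_power: "\<exists>m>0. \<forall>x\<in>Ker. f (t_conj (int m) x) mod int n = f x mod int n"
proof -
  obtain Y where Y: "finite Y" "Y \<subseteq> carrier G" "Ker = generate G Y" using fgA by (auto simp: fin_gen_def)
  have YA: "y \<in> Ker" if "y \<in> Y" for y using Y(3) generate.incl[OF that, of G] by simp
  \<comment> \<open>Values on the generators of \<open>f\<close> modulo \<open>n\<close> after
    conjugation by powers of \<open>t\<close>; there are finitely many such tables, so two exponents
    share one.\<close>
  define F where "F = (\<lambda>j::nat. \<lambda>y\<in>Y. f (t_conj (int j) y) mod int n)"
  have "range F \<subseteq> Y \<rightarrow>\<^sub>E {0..<int n}" using n by (auto simp: F_def)
  moreover have "finite (Y \<rightarrow>\<^sub>E {0..<int n})" using Y by (intro finite_PiE) auto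
  ultimately have "finite (range F)" by (rule finite_subset)
  then have "\<not> inj F" using finite_imageD[of F UNIV] by auto
  then obtain j k where jk: "F j = F k" "j < k"
    unfolding inj_def by (metis linorder_neqE_nat)
  have eq: "f (t_conj (int j) y) mod int n = f (t_conj (int k) y) mod int n" if "y \<in> generate G Y" for y
    using that
  proof (induction rule: generate.induct)
    case one
    then show ?case by (simp add: t_conj_def)
  next
    case (incl y)
    then show ?case using fun_cong[OF jk(1), of y] by (simp add: F_def)
  next
    case (inv y)
    have yA: "y \<in> Ker" using YA inv by simp
    have "t_conj i (inv y) = inv (t_conj i y)" for i
      using yA by (simp add: t_conj_def inv_mult_group m_assoc)
    then have minus: "f (t_conj i (inv y)) = - f (t_conj i y)" for i using yA by simp
    have "f (t_conj (int j) y) mod int n = f (t_conj (int k) y) mod int n"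
      using fun_cong[OF jk(1), of y] inv by (simp add: F_def)
    then show ?case unfolding minus by (rule mod_minus_cong)
  next
    case (eng x y)
    then have "x \<in> Ker" "y \<in> Ker" unfolding Y(3) by simp_all
    then have add: "f (t_conj i (x \<otimes> y)) = f (t_conj i x) + f (t_conj i y)" for i
      by (simp add: t_conj_mult f_mult)
    show ?case unfolding add by (rule mod_add_cong[OF eng.IH])
  qed
  have "f (t_conj (int (k - j)) x) mod int n = f x mod int n" if x: "x \<in> Ker" for x
  proof -
    \<comment> \<open>Evaluation at the conjugate by the power \<open>-j\<close> cancels the smaller
      exponent and leaves \<open>k - j\<close> against 0.\<close>
    have "t_conj (- int j) x \<in> Ker" using x by simp
    from eq[folded Y(3), OF this]
    have "f (t_conj (int j + - int j) x) mod int n = f (t_conj (int k + - int j) x) mod int n"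
      using x by (simp only: t_conj_add Ker_H)
    then show ?thesis using jk(2) x by (simp add: of_nat_diff)
  qed
  then show ?thesis using jk(2) by (intro exI[of _ "k - j"]) auto
qed

text \<open>The function \<open>c i\<close> labels the cosets of \<open>L i\<close> in
  \<open>H\<close> by a residue modulo \<open>m\<close> and one modulo \<open>n\<close>. All pairs
  occur, so the index of \<open>L i\<close> in the group is
  \<open>card (rcosets H) * (nat m * n)\<close>, whatever \<open>i\<close> is.\<close>

lemma ex_subgroups_same_index:
  assumes fin: "finite (rcosets H)"
  shows "\<exists>N>0. \<exists>\<L>. card \<L> = n \<and> (\<forall>L\<in>\<L>. subgroup L G \<and> finite (rcosets L) \<and> card (rcosets L) = N)"
proof -
  obtain m0 where m0: "m0 > 0" "\<And>x. x \<in> Ker \<Longrightarrow> f (t_conj (int m0) x) mod int n = f x mod int n"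
    using ex_fixing_power by blast
  define m where "m = int m0"
  have m: "m > 0" "\<And>x. x \<in> Ker \<Longrightarrow> f (t_conj m x) mod int n = f x mod int n"
    using m0 by (simp_all add: m_def)
  have fix_nat: "f (t_conj (m * int k) x) mod int n = f x mod int n" if "x \<in> Ker" for k x
    using that
  proof (induction k arbitrary: x)
    case (Suc k)
    have "m * int (Suc k) = m * int k + m" by (simp add: algebra_simps)
    then show ?case using Suc m by (simp add: t_conj_add)
  qed simp
  have fix_int: "f (t_conj k x) mod int n = f x mod int n" if x: "x \<in> Ker" and k: "m dvd k" for k x
  proof -
    obtain l where l: "k = m * l" using k by (auto elim: dvdE)
    show ?thesis
    proof (cases "l \<ge> 0")
      case True
      then show ?thesis using fix_nat[OF x, of "nat l"] l by simp
    next
      case False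
      have "f (t_conj (m * int (nat (- l))) (t_conj k x)) mod int n = f (t_conj k x) mod int n"
        using x by (intro fix_nat) simp
      moreover have "t_conj (m * int (nat (- l))) (t_conj k x) = t_conj (m * int (nat (- l)) + k) x"
        using x by (simp add: t_conj_add)
      moreover have "m * int (nat (- l)) + k = 0" using False l by simp
      ultimately show ?thesis using x by simp
    qed
  qed
  define \<phi> where "\<phi> = (\<lambda>x. f (x \<otimes> inv (t [^] e x)))"
  note inA = t_component_in_Ker
  \<comment> \<open>Moving \<open>t [^] e x\<close> past the kernel part of \<open>y\<close>
    conjugates that part, which preserves \<open>f\<close> modulo \<open>n\<close> when
    \<open>m\<close> divides \<open>e x\<close>.\<close>
  have \<phi>_mult: "\<phi> (x \<otimes> y) mod int n = (\<phi> x + \<phi> y) mod int n" if xy: "x \<in> H" "y \<in> H" "m dvd e x" for x y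
  proof -
    let ?a = "x \<otimes> inv (t [^] e x)" and ?b = "y \<otimes> inv (t [^] e y)"
    have "x \<otimes> y \<otimes> inv (t [^] e (x \<otimes> y)) = x \<otimes> y \<otimes> (inv (t [^] e y) \<otimes> inv (t [^] e x))"
      using xy by (simp add: e_mult int_pow_mult inv_mult_group)
    also have "\<dots> = ?a \<otimes> (t [^] e x \<otimes> ?b \<otimes> inv (t [^] e x))"
    proof -
      have "inv (t [^] e x) \<otimes> (t [^] e x \<otimes> z) = z" if "z \<in> carrier G" for z
        using that by (simp flip: m_assoc)
      then show ?thesis using xy by (simp add: m_assoc)
    qed
    also have "\<dots> = ?a \<otimes> t_conj (e x) ?b" by (simp add: t_conj_def)
    finally have "\<phi> (x \<otimes> y) = \<phi> x + f (t_conj (e x) ?b)"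
      using inA xy by (simp add: \<phi>_def f_mult)
    moreover have "f (t_conj (e x) ?b) mod int n = \<phi> y mod int n"
      unfolding \<phi>_def by (rule fix_int) (use inA xy in auto)
    ultimately show ?thesis by (metis mod_add_right_eq)
  qed
  \<comment> \<open>The quotient \<open>e x div m\<close> is the exponent of
    \<open>u = t [^] m\<close>; subtracting \<open>i\<close> times it measures how far
    \<open>x\<close> is from satisfying the equation of \<open>L i\<close>.\<close>
  define c where "c = (\<lambda>i x. (e x mod m, (\<phi> x - i * (e x div m)) mod int n))"
  define L where "L = (\<lambda>i. {x \<in> H. m dvd e x \<and> \<phi> x mod int n = (i * (e x div m)) mod int n})"
  have c_iff: "c i x = c i y \<longleftrightarrow> x \<otimes> inv y \<in> L i" if xy: "x \<in> H" "y \<in> H" for i x y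
  proof (cases "e x mod m = e y mod m")
    case True
    define w where "w = x \<otimes> inv y"
    have w: "w \<in> H" "e w = e x - e y" using xy by (simp_all add: w_def e_mult)
    have dv: "m dvd e w" using True w by (simp add: mod_eq_dvd_iff)
    have x: "x = w \<otimes> y" using xy by (simp add: w_def m_assoc)
    have "\<phi> x mod int n = (\<phi> w + \<phi> y) mod int n"
      unfolding x by (rule \<phi>_mult[OF w(1) xy(2) dv])
    then have 1: "(\<phi> x - \<phi> y - \<phi> w) mod int n = 0"
      by (simp add: mod_eq_dvd_iff algebra_simps flip: dvd_eq_mod_eq_0)
    have "m * (e x div m) = e x - e x mod m" "m * (e y div m) = e y - e y mod m"
      by (simp_all add: minus_mod_eq_mult_div)
    then have "e w = m * (e x div m - e y div m)"
      unfolding w(2) right_diff_distrib using True by linarith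
    then have 2: "e w div m = e x div m - e y div m" using m by simp
    have "c i x = c i y \<longleftrightarrow> int n dvd (\<phi> x - i * (e x div m)) - (\<phi> y - i * (e y div m))"
      using True by (simp add: c_def mod_eq_dvd_iff)
    also have "(\<phi> x - i * (e x div m)) - (\<phi> y - i * (e y div m)) = (\<phi> x - \<phi> y - \<phi> w) + (\<phi> w - i * (e w div m))"
      unfolding 2 by (simp add: algebra_simps)
    also have "int n dvd \<dots> \<longleftrightarrow> int n dvd (\<phi> w - i * (e w div m))"
      using 1 by (intro dvd_add_right_iff) auto
    also have "\<dots> \<longleftrightarrow> w \<in> L i" using w dv by (simp add: L_def mod_eq_dvd_iff)
    finally show ?thesis by (simp add: w_def)
  next
    case False
    then show ?thesis using xy by (auto simp: c_def L_def e_mult mod_eq_dvd_iff)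
  qed
  have \<phi>_one: "\<phi> \<one> = 0" by (simp add: \<phi>_def)
  \<comment> \<open>By \<open>c_iff\<close>, \<open>L i\<close> consists of the elements of
    \<open>H\<close> with the label of \<open>\<one>\<close>; closure under inverses and products
    follows by comparing labels.\<close>
  have subL: "subgroup (L i) G" for i
  proof (rule subgroupI)
    show "L i \<subseteq> carrier G" by (auto simp: L_def)
    show "L i \<noteq> {}" using c_iff[of \<one> \<one> i] by auto
    fix x y assume x: "x \<in> L i"
    then have xH: "x \<in> H" by (simp add: L_def)
    have x1: "c i x = c i \<one>" using c_iff[of x \<one> i] xH x by simp
    then show xi: "inv x \<in> L i" using c_iff[of \<one> x i] xH by simp
    assume y: "y \<in> L i"
    then have yH: "y \<in> H" by (simp add: L_def)
    have "c i y = c i \<one>" using c_iff[of y \<one> i] yH y by simp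
    moreover have "c i (inv x) = c i \<one>" using c_iff[of "inv x" \<one> i] xH xi by simp
    moreover have "inv (inv x) = x" "inv (inv y) = y" using xH yH by simp_all
    moreover have "c i (inv y) = c i \<one>" using c_iff[of \<one> y i] c_iff[of "inv y" \<one> i] yH calculation(1) by simp
    ultimately show "x \<otimes> y \<in> L i" using c_iff[of x "inv y" i] x1 xH yH by simp
  qed
  have imgc: "c i ` H = {0..<m} \<times> {0..<int n}" for i
  proof (intro equalityI subsetI)
    fix z assume "z \<in> c i ` H"
    then show "z \<in> {0..<m} \<times> {0..<int n}" using m n by (auto simp: c_def)
  next
    fix z assume "z \<in> {0..<m} \<times> {0..<int n}"
    then obtain r v where z: "z = (r, v)" "0 \<le> r" "r < m" "0 \<le> v" "v < int n" by auto
    \<comment> \<open>As \<open>0 \<le> r < m\<close>, the quotient \<open>e x div m\<close> is 0,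
      so this witness serves for every \<open>i\<close>.\<close>
    define x where "x = s [^] nat v \<otimes> t [^] r"
    have sA: "s [^] nat v \<in> Ker" "f (s [^] nat v) = v" using s_pow[of "nat v"] z by simp_all
    have x: "x \<in> H" "e x = r" using sA by (simp_all add: x_def e_mult)
    have "x \<otimes> inv (t [^] r) = s [^] nat v" using sA by (simp add: x_def m_assoc)
    then have "\<phi> x = v" using x sA by (simp add: \<phi>_def)
    then have "c i x = z" using x z by (simp add: c_def)
    then show "z \<in> c i ` H" using x by blast
  qed
  define N where "N = card (rcosets H) * (nat m * n)"
  have index: "finite (rcosets (L i)) \<and> card (rcosets (L i)) = N" for i
  proof -
    have "\<exists>h. bij_betw h (rcosets (L i)) ((rcosets H) \<times> c i ` H)"
      using c_iff by (intro bij_betw_rcosets_times_image[OF H subL]) (auto simp: L_def)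
    then obtain h where h: "bij_betw h (rcosets (L i)) ((rcosets H) \<times> ({0..<m} \<times> {0..<int n}))"
      by (auto simp: imgc)
    show ?thesis
      using bij_betw_finite[OF h] bij_betw_same_card[OF h] fin
      by (simp add: N_def card_cartesian_product)
  qed
  have "N > 0"
  proof -
    have "card (rcosets H) > 0" using fin by (auto simp: card_gt_0_iff RCOSETS_def)
    then show ?thesis using m n by (simp add: N_def)
  qed
  moreover have "inj_on L {0..<int n}"
  proof (rule inj_onI)
    fix i j assume ij: "i \<in> {0..<int n}" "j \<in> {0..<int n}" "L i = L j"
    \<comment> \<open>Here the quotient \<open>e x div m\<close> is 1, so the element lies in
      \<open>L k\<close> exactly when \<open>k\<close> is congruent to \<open>i\<close> modulo
      \<open>n\<close>.\<close>
    define x where "x = s [^] nat i \<otimes> t [^] m"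
    have sA: "s [^] nat i \<in> Ker" "f (s [^] nat i) = i" using s_pow[of "nat i"] ij by simp_all
    have x: "x \<in> H" "e x = m" using sA by (simp_all add: x_def e_mult)
    have "x \<otimes> inv (t [^] m) = s [^] nat i" using sA by (simp add: x_def m_assoc)
    then have "\<phi> x = i" using x sA by (simp add: \<phi>_def)
    then have "x \<in> L k \<longleftrightarrow> i mod int n = k mod int n" for k using x m by (simp add: L_def)
    then have "i mod int n = j mod int n" using ij(3) by blast
    then show "i = j" using ij by simp
  qed
  then have "card (L ` {0..<int n}) = n" by (simp add: card_image)
  ultimately show ?thesis using subL index by (intro exI[of _ N] conjI exI[of _ "L ` {0..<int n}"]) auto
qed

end

text \<open>\<open>e\<close> is the exponent of a coset with respect to a generator of the quotient,
  well defined because the quotient is infinite; \<open>t\<close> is any preimage of that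
  generator.\<close>

lemma (in group) int_extension_of_cyclic_quotient:
  assumes H: "subgroup H G" and S: "S \<lhd> G\<lparr>carrier := H\<rparr>"
    and Q: "cyclic_group (G\<lparr>carrier := H\<rparr> Mod S)" "infinite (carrier (G\<lparr>carrier := H\<rparr> Mod S))"
  shows "\<exists>e t. int_extension G H e t \<and> int_extension.Ker H e = S"
proof -
  let ?K = "G\<lparr>carrier := H\<rparr>"
  let ?Q = "?K Mod S"
  interpret N: normal S ?K by (rule S)
  interpret Q: group ?Q by (rule N.factorgroup_is_group)
  obtain q where q: "q \<in> carrier ?Q" "carrier ?Q = range (\<lambda>n::int. q [^]\<^bsub>?Q\<^esub> n)"
    using Q(1) Q.cyclic_group by auto
  define \<pi> where "\<pi> = (\<lambda>x. S #>\<^bsub>?K\<^esub> x)"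
  have \<pi>_hom: "\<pi> \<in> hom ?K ?Q" unfolding \<pi>_def by (rule N.r_coset_hom_Mod)
  have \<pi>_in: "\<pi> x \<in> carrier ?Q" if "x \<in> H" for x
    using hom_in_carrier[OF \<pi>_hom, of x] that by simp
  define e where "e = (\<lambda>x. SOME k::int. \<pi> x = q [^]\<^bsub>?Q\<^esub> k)"
  have e: "\<pi> x = q [^]\<^bsub>?Q\<^esub> e x" if "x \<in> H" for x
  proof -
    have "\<exists>k::int. \<pi> x = q [^]\<^bsub>?Q\<^esub> k" using \<pi>_in[OF that] unfolding q(2) by auto
    then show ?thesis unfolding e_def by (rule someI_ex)
  qed
  have e_eqI: "e x = k" if "x \<in> H" "\<pi> x = q [^]\<^bsub>?Q\<^esub> k" for x k
    using Q.infinite_cyclic_int_pow_inj[OF q Q(2), of "e x" k] e[OF that(1)] that(2) by simp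
  have "q \<in> \<pi> ` H" using q(1) by (auto simp: FactGroup_def RCOSETS_def \<pi>_def)
  then obtain t where t: "t \<in> H" "q = \<pi> t" by auto
  have ext: "int_extension G H e t"
  proof (intro int_extension.intro int_extension_axioms.intro)
    show "group G" by (rule is_group)
    show "subgroup H G" by (rule H)
    show "t \<in> H" by (rule t)
    show "e t = 1" using t q(1) by (intro e_eqI) simp_all
    fix x y assume xy: "x \<in> H" "y \<in> H"
    have "\<pi> (x \<otimes> y) = \<pi> x \<otimes>\<^bsub>?Q\<^esub> \<pi> y" using hom_mult[OF \<pi>_hom, of x y] xy by simp
    also have "\<dots> = q [^]\<^bsub>?Q\<^esub> (e x + e y)" using e xy q(1) by (simp add: Q.int_pow_mult)
    finally show "e (x \<otimes> y) = e x + e y"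
      using xy subgroup.m_closed[OF H] by (intro e_eqI) auto
  qed
  have "x \<in> S \<longleftrightarrow> e x = 0" if x: "x \<in> H" for x
  proof -
    have "x \<in> S \<longleftrightarrow> \<pi> x = S"
      unfolding \<pi>_def using N.coset_join1[of S x] N.coset_join2[of x S] N.subgroup_axioms x by auto
    also have "\<dots> \<longleftrightarrow> \<pi> x = q [^]\<^bsub>?Q\<^esub> (0::int)" by (simp add: FactGroup_def)
    also have "\<dots> \<longleftrightarrow> e x = 0" using e_eqI[OF x, of 0] e[OF x] by auto
    finally show ?thesis .
  qed
  moreover have "S \<subseteq> H" using N.subset by simp
  ultimately have "int_extension.Ker H e = S" unfolding int_extension.Ker_def[OF ext] by blast
  then show ?thesis using ext by blast
qed

text \<open>The series gives finite generation from the bottom up, one added generator per factor;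
  its top two factors give the subgroups.\<close>

lemma (in group) hirsch_series_unbounded:
  assumes "has_hirsch_length G h" "h \<ge> 2"
  shows "fin_gen (carrier G)"
    and "\<exists>N>0. \<exists>\<L>. card \<L> = n \<and> (\<forall>L\<in>\<L>. subgroup L G \<and> finite (rcosets L) \<and> card (rcosets L) = N)"
proof -
  obtain S where S: "subnormal_series G (\<lambda>Q. cyclic_group Q \<and> infinite (carrier Q)) h S"
    and Sh: "subgroup (S h) G" "finite (rcosets (S h))"
    using assms(1) unfolding has_hirsch_length_def finite_index_subgroups_def by blast
  have S0: "S 0 = {\<one>}"
    using S unfolding subnormal_series_def by blast
  have series: "S k \<lhd> G\<lparr>carrier := S (Suc k)\<rparr>"
    "cyclic_group (G\<lparr>carrier := S (Suc k)\<rparr> Mod S k)"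
    "infinite (carrier (G\<lparr>carrier := S (Suc k)\<rparr> Mod S k))" if "k < h" for k
    using S that unfolding subnormal_series_def by blast+
  \<comment> \<open>The induction descends, since only the top term is given as a subgroup of the
    group.\<close>
  have sub: "subgroup (S k) G" if "k \<le> h" for k
    using that
  proof (induction rule: inc_induct)
    case (step k)
    then show ?case
      using incl_subgroup[of "S (Suc k)" "S k"] normal_imp_subgroup[OF series(1)[of k]] by blast
  qed (rule Sh)
  have ext: "\<exists>e t. int_extension G (S (Suc k)) e t \<and> int_extension.Ker (S (Suc k)) e = S k" if "k < h" for k
    using that by (intro int_extension_of_cyclic_quotient sub series) auto
  have fg: "fin_gen (S k)" if "k \<le> h" for k
    using that
  proof (induction k)
    case 0
    show ?case unfolding fin_gen_def S0 by (intro exI[of _ "{}"]) (simp add: generate_empty)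
  next
    case (Suc k)
    then obtain e t where e: "int_extension G (S (Suc k)) e t" "int_extension.Ker (S (Suc k)) e = S k"
      using ext[of k] by auto
    then show ?case using int_extension.fin_gen_extension[OF e(1)] Suc by simp
  qed
  show "fin_gen (carrier G)" by (rule fin_gen_if_finite_index[OF Sh fg]) simp
  show "\<exists>N>0. \<exists>\<L>. card \<L> = n \<and> (\<forall>L\<in>\<L>. subgroup L G \<and> finite (rcosets L) \<and> card (rcosets L) = N)"
  proof (cases "n = 0")
    case True
    then show ?thesis by (intro exI[of _ 1] conjI exI[of _ "{}"]) auto
  next
    case False
    obtain k where k: "h = Suc (Suc k)" using assms(2) by (metis Suc_le_D numeral_2_eq_2 Suc_le_mono)
    obtain e t where e: "int_extension G (S h) e t" "int_extension.Ker (S h) e = S (Suc k)"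
      using ext[of "Suc k"] k by auto
    obtain f s where f: "int_extension G (S (Suc k)) f s"
      using ext[of k] k by auto
    have "int_extension2 G (S h) e t f s n"
    proof (intro int_extension2.intro e int_extension2_axioms.intro)
      show "fin_gen (int_extension.Ker (S h) e)" using fg[of "Suc k"] k e by simp
    qed (use False e(2) int_extension.e_mult[OF f] int_extension.t_in[OF f] int_extension.e_t[OF f] in auto)
    from int_extension2.ex_subgroups_same_index[OF this Sh(2)] show ?thesis .
  qed
qed

section \<open>Growth of the coefficients\<close>

lemma power_div_fact_le_exp:
  fixes x :: real
  assumes "x \<ge> 0"
  shows "x ^ k / fact k \<le> exp x"
proof -
  have s: "(\<lambda>n. x ^ n /\<^sub>R fact n) sums exp x" by (rule exp_converges)
  have "(\<Sum>n\<in>{k}. x ^ n /\<^sub>R fact n) \<le> (\<Sum>n. x ^ n /\<^sub>R fact n)"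
    using assms by (intro sum_le_suminf sums_summable[OF s]) auto
  then show ?thesis using sums_unique[OF s] by (simp add: divide_inverse mult.commute)
qed

lemma fps_conv_radius_ge_1_if_subexponential:
  fixes E :: "complex fps"
  assumes "\<And>\<epsilon>. \<epsilon> > 0 \<Longrightarrow> eventually (\<lambda>n. norm (fps_nth E n) \<le> C * real n ^ k * exp (\<epsilon> * real n)) sequentially"
  shows "fps_conv_radius E \<ge> 1"
  unfolding fps_conv_radius_def
proof (rule conv_radius_geI_ex')
  fix r :: real assume r: "0 < r" "ereal r < 1"
  then have r1: "r < 1" by simp
  \<comment> \<open>Thus \<open>r ^ n = exp (- 4 * \<epsilon> * n)\<close>. One
    \<open>\<epsilon>\<close> is spent on the hypothesis and one on the polynomial factor, which
    leaves the geometric decay of \<open>y\<close>.\<close>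
  define \<epsilon> where "\<epsilon> = - ln r / 4"
  have \<epsilon>: "\<epsilon> > 0" using r r1 by (simp add: \<epsilon>_def)
  have r_exp: "r ^ n = exp (- 4 * \<epsilon> * real n)" for n
  proof -
    have "r = exp (- 4 * \<epsilon>)" using r by (simp add: \<epsilon>_def)
    then have "r ^ n = exp (- 4 * \<epsilon>) ^ n" by simp
    then show ?thesis by (simp add: exp_of_nat_mult[symmetric] mult.commute)
  qed
  define y where "y = exp (- 2 * \<epsilon>)"
  have y: "0 \<le> y" "y < 1" using \<epsilon> by (auto simp: y_def)
  have y_exp: "y ^ n = exp (- 2 * \<epsilon> * real n)" for n
    by (simp add: y_def exp_of_nat_mult[symmetric] mult.commute)
  define D where "D = \<bar>C\<bar> * (fact k / \<epsilon> ^ k)"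
  have "eventually (\<lambda>n. norm (fps_nth E n * of_real r ^ n) \<le> D * y ^ n) sequentially"
    using assms[OF \<epsilon>]
  proof eventually_elim
    case (elim n)
    have "(\<epsilon> * real n) ^ k / fact k \<le> exp (\<epsilon> * real n)"
      using \<epsilon> by (intro power_div_fact_le_exp) simp
    then have nk: "real n ^ k \<le> (fact k / \<epsilon> ^ k) * exp (\<epsilon> * real n)"
      using \<epsilon> by (simp add: power_mult_distrib field_simps)
    have "norm (fps_nth E n * of_real r ^ n) = norm (fps_nth E n) * r ^ n"
      using r by (simp add: norm_mult norm_power)
    also have "\<dots> \<le> (\<bar>C\<bar> * real n ^ k * exp (\<epsilon> * real n)) * r ^ n"
    proof (rule mult_right_mono)
      have "C * real n ^ k * exp (\<epsilon> * real n) \<le> \<bar>C\<bar> * real n ^ k * exp (\<epsilon> * real n)"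
        by (intro mult_right_mono) auto
      then show "norm (fps_nth E n) \<le> \<bar>C\<bar> * real n ^ k * exp (\<epsilon> * real n)" using elim by linarith
    qed (use r in simp)
    also have "\<dots> \<le> (\<bar>C\<bar> * ((fact k / \<epsilon> ^ k) * exp (\<epsilon> * real n)) * exp (\<epsilon> * real n)) * r ^ n"
      using r nk by (intro mult_right_mono mult_left_mono) auto
    also have "\<dots> = D * (exp (\<epsilon> * real n) * exp (\<epsilon> * real n) * r ^ n)"
      by (simp add: D_def mult_ac)
    also have "exp (\<epsilon> * real n) * exp (\<epsilon> * real n) * r ^ n = y ^ n"
      by (simp add: r_exp y_exp exp_add[symmetric])
    finally show ?case .
  qed
  moreover have "summable (\<lambda>n. D * y ^ n)"
    using y by (intro summable_mult summable_geometric) simp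
  ultimately show "summable (\<lambda>n. fps_nth E n * of_real r ^ n)"
    by (rule summable_comparison_test_ev)
qed

text \<open>The suprema over index at least \<open>n\<close> decrease with \<open>n\<close>, so
  their limit is an infimum, and one of them is already below \<open>\<epsilon>\<close>.\<close>

lemma num_fixed_le_exp:
  assumes "upper_growth_rate G X \<alpha> = 0" "\<epsilon> > 0"
  shows "\<exists>n0. \<forall>L \<in> finite_index_subgroups G. n0 \<le> subgroup_index G L \<longrightarrow>
           real (num_fixed X \<alpha> L) \<le> exp (\<epsilon> * real (subgroup_index G L))"
proof -
  define q where "q = (\<lambda>L. log_nat (num_fixed X \<alpha> L) / ereal (real (subgroup_index G L)))"
  define v where "v = (\<lambda>n. SUP L \<in> {L \<in> finite_index_subgroups G. n \<le> subgroup_index G L}. q L)"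
  have "decseq v"
    unfolding decseq_def v_def by (intro allI impI SUP_subset_mono) auto
  then have "v \<longlonglongrightarrow> (INF n. v n)" by (rule LIMSEQ_INF)
  from limI[OF this] have "(INF n. v n) = 0"
    using assms(1) by (simp add: upper_growth_rate_def v_def q_def)
  then have "(INF n. v n) < ereal \<epsilon>" using assms(2) by simp
  then obtain m where m: "v m < ereal \<epsilon>" unfolding INF_less_iff by blast
  \<comment> \<open>\<open>Suc m\<close> in place of \<open>m\<close> makes the index visibly
    positive, so that the quotient can be cleared.\<close>
  have "real (num_fixed X \<alpha> L) \<le> exp (\<epsilon> * real (subgroup_index G L))"
    if L: "L \<in> finite_index_subgroups G" "Suc m \<le> subgroup_index G L" for L
  proof (cases "num_fixed X \<alpha> L = 0")
    case False
    have "q L \<le> v m" unfolding v_def using L by (intro SUP_upper) auto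
    then have "q L < ereal \<epsilon>" using m by simp
    then have "ln (real (num_fixed X \<alpha> L)) / real (subgroup_index G L) < \<epsilon>"
      using False L(2) by (simp add: q_def log_nat_def)
    then have "ln (real (num_fixed X \<alpha> L)) < \<epsilon> * real (subgroup_index G L)"
      using L(2) by (simp add: pos_divide_less_eq)
    then have "exp (ln (real (num_fixed X \<alpha> L))) < exp (\<epsilon> * real (subgroup_index G L))" by simp
    then show ?thesis using False by simp
  qed simp
  then show ?thesis by blast
qed

section \<open>From rationality to the natural boundary\<close>

theorem proposition2p6:
  fixes G :: "('a, 'c) monoid_scheme"
    and X :: "'b set"
    and \<alpha> :: "'a \<Rightarrow> 'b \<Rightarrow> 'b"
    and h :: nat
  assumes "group G"
    and "polycyclic_by_finite G"
    and "polynomial_subgroup_growth G"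
    and "has_hirsch_length G h" and "h \<ge> 2"
    and "group_action G X \<alpha>"
    and "\<And>L. L \<in> finite_index_subgroups G \<Longrightarrow> finite (fixed_points X \<alpha> L)"
    and "finite {L \<in> finite_index_subgroups G. num_fixed X \<alpha> L = 0}"
    and "upper_growth_rate G X \<alpha> = 0"
    and "\<And>n. fps_nth (dynamical_zeta G X \<alpha>) n \<in> \<int>"
  shows "has_natural_boundary (dynamical_zeta G X \<alpha>) 1"
proof -
  interpret group G by (rule assms(1))
  define I where "I = (\<lambda>n. {L \<in> finite_index_subgroups G. subgroup_index G L = n})"
  define F where "F = num_fixed X \<alpha>"
  define b where "b = (\<lambda>n. \<Sum>L\<in>I n. F L)"
  define E where "E = zeta_exponent G X \<alpha>"
  define f where "f = dynamical_zeta G X \<alpha>"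
  have f_def': "f = fps_exp 1 oo E" by (simp add: f_def E_def dynamical_zeta_def)
  have I_eq: "I n = {L. subgroup L G \<and> finite (rcosets\<^bsub>G\<^esub> L) \<and> card (rcosets\<^bsub>G\<^esub> L) = n}" for n
    by (auto simp: I_def finite_index_subgroups_def subgroup_index_def)
  have finI: "finite (I n)" for n
    unfolding I_eq by (rule finite_subgroups_of_index[OF hirsch_series_unbounded(1)[OF assms(4,5)]])
  have E_nth: "fps_nth E n = of_nat (b n) / of_nat n" for n
  proof -
    have "fps_nth E n = (\<Sum>L\<in>I n. of_nat (F L) / of_nat n)"
      unfolding E_def zeta_exponent_def fps_nth_Abs_fps I_def F_def by (intro sum.cong) auto
    then show ?thesis by (simp add: b_def sum_divide_distrib)
  qed
  then have E0: "fps_nth E 0 = 0" by simp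
  obtain C k where Ck: "\<And>n. n \<ge> 1 \<Longrightarrow> real (card (I n)) \<le> C * real n ^ k"
    using assms(3) unfolding polynomial_subgroup_growth_def num_subgroups_def I_def by blast
  have E_radius: "fps_conv_radius E \<ge> 1"
  proof (rule fps_conv_radius_ge_1_if_subexponential)
    fix \<epsilon> :: real assume "\<epsilon> > 0"
    from num_fixed_le_exp[OF assms(9) this] obtain n0 where
      n0: "\<And>L. L \<in> finite_index_subgroups G \<Longrightarrow> n0 \<le> subgroup_index G L \<Longrightarrow>
           real (F L) \<le> exp (\<epsilon> * real (subgroup_index G L))" unfolding F_def by blast
    show "eventually (\<lambda>n. norm (fps_nth E n) \<le> C * real n ^ k * exp (\<epsilon> * real n)) sequentially"
      using eventually_ge_at_top[of "max 1 n0"]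
    proof eventually_elim
      case (elim n)
      have "norm (fps_nth E n) = real (b n) / real n" by (simp add: E_nth norm_divide)
      also have "\<dots> \<le> real (b n) / 1" using elim by (intro divide_left_mono) auto
      also have "\<dots> = (\<Sum>L\<in>I n. real (F L))" by (simp add: b_def)
      also have "\<dots> \<le> (\<Sum>L\<in>I n. exp (\<epsilon> * real n))"
      proof (rule sum_mono)
        fix L assume "L \<in> I n"
        then show "real (F L) \<le> exp (\<epsilon> * real n)" using n0[of L] elim by (simp add: I_def)
      qed
      also have "\<dots> = real (card (I n)) * exp (\<epsilon> * real n)" by simp
      also have "\<dots> \<le> (C * real n ^ k) * exp (\<epsilon> * real n)"
        using Ck[of n] elim by (intro mult_right_mono) auto
      finally show ?case .
    qed
  qed
  note f_radius = exp_compose_eval_fps(1)[OF E0 E_radius, folded f_def']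
  have not_rational: False if rat: "B \<noteq> 0" "f * fps_of_poly B = fps_of_poly P" for B P
  proof -
    obtain M where M: "\<And>n. norm (of_nat n * fps_nth E n) \<le> M"
      using bounded_log_coeffs_if_rational[OF E0 E_radius rat[unfolded f_def']] by blast
    \<comment> \<open>Each subgroup outside \<open>Z\<close> contributes at least 1 to
      \<open>b\<close>. The exceptions are finite in number over all indices together, so one
      constant accounts for them.\<close>
    define Z where "Z = {L \<in> finite_index_subgroups G. F L = 0}"
    have Z: "finite Z" using assms(8) by (simp add: Z_def F_def)
    obtain n where n: "real n > M + real (card Z)" using reals_Archimedean2 by blast
    obtain N \<L> where N: "N > 0" "card \<L> = n" "\<L> \<subseteq> I N"
      using hirsch_series_unbounded(2)[OF assms(4,5), of n] unfolding I_eq by blast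
    have "n \<le> card (I N)" using N finI card_mono by metis
    also have "\<dots> \<le> card (I N - Z) + card Z"
      using card_Un_le[of "I N - Z" Z] card_mono[of "(I N - Z) \<union> Z" "I N"] finI[of N] Z by fastforce
    also have "card (I N - Z) \<le> b N"
    proof -
      have "card (I N - Z) = (\<Sum>L\<in>I N - Z. 1)" by simp
      also have "\<dots> \<le> (\<Sum>L\<in>I N - Z. F L)" by (intro sum_mono) (auto simp: Z_def I_def Suc_le_eq)
      also have "\<dots> \<le> b N" unfolding b_def by (intro sum_mono2 finI) auto
      finally show ?thesis .
    qed
    finally have "real n \<le> real (b N) + real (card Z)" by simp
    moreover have "real (b N) \<le> M"
      using M[of N] N(1) by (simp add: E_nth)
    ultimately show False using n by simp
  qed
  have no_continuation: False
    if "norm u = 1" "r > 0" "g holomorphic_on ball u r" "\<And>z. z \<in> ball u r \<inter> ball 0 1 \<Longrightarrow> g z = eval_fps f z" for u r g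
    using polya_carlson[OF _ f_radius that] assms(10) not_rational unfolding f_def by blast
  \<comment> \<open>With a larger radius the series itself would be a continuation across the point
    1.\<close>
  have "fps_conv_radius f = 1"
  proof (rule antisym[OF leI f_radius], rule notI)
    assume "fps_conv_radius f > 1"
    then obtain R where R: "1 < ereal R" "ereal R < fps_conv_radius f"
      using ereal_dense2 by blast
    have "ball (1::complex) (R - 1) \<subseteq> eball 0 (fps_conv_radius f)"
    proof
      fix z :: complex assume "z \<in> ball 1 (R - 1)"
      then have "norm z < R" using norm_triangle_ineq[of 1 "z - 1"] by (simp add: dist_norm norm_minus_commute)
      then show "z \<in> eball 0 (fps_conv_radius f)"
        using R(2) less_trans[of "ereal (norm z)" "ereal R"] by (simp add: in_eball_iff)
    qed
    then have "eval_fps f holomorphic_on ball 1 (R - 1)" by (rule holomorphic_on_eval_fps)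
    then show False using no_continuation[of 1 "R - 1" "eval_fps f"] R(1) by simp
  qed
  moreover have "\<not> (\<exists>r>0. \<exists>g. g holomorphic_on ball w r \<and>
      (\<forall>z\<in>ball w r \<inter> ball 0 1. g z = eval_fps f z))" if "w \<in> sphere 0 1" for w
    using no_continuation[of w] that by (metis dist_0_norm mem_sphere)
  ultimately show ?thesis
    unfolding has_natural_boundary_def f_def[symmetric] by (simp add: one_ereal_def)
qed

end
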